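(* Let $g>0$ and $c\in\mathbb{R}$. There are no (holomorphic) crested wave solutions $W$ of the equation $$2g\,\Im W=c^2\,\frac{W_\alpha+\bar W_\alpha+|W_\alpha|^2}{|1+W_\alpha|^2}$$ such that $$\frac{W_\alpha}{1+W_\alpha}\in\dot B^{1/2}_{2,1}(\mathbb{R})\qquad\text{and}\qquad |1+W_\alpha|\ge\delta>0\ \text{ for some constant }\delta .$$
   Context: $W=W(\alpha)$ is a complex valued function on $\mathbb{R}$, $W_\alpha=\partial_\alpha W$, and $Z=\alpha+W$. Besov space. Let $1=\sum_{k\in\mathbb{Z}}P_k$ be a standard dyadic Littlewood-Paley decomposition on $\mathbb{R}$, where $P_k$ selects frequencies $\approx 2^k$. Then $\|u\|_{\dot B^{1/2}_{2,1}}=\sum_{k\in\mathbb{Z}}2^{k/2}\|P_ku\|_{L^2}$. Elements of $\dot B^{1/2}_{2,1}$ are realized as functions $u=\sum_k P_ku$ (uniformly convergent series), so that they are bounded and continuous and vanish at infinity. "Holomorphic": $W$ extends continuously to the closed lower half plane and holomorphically to $\mathbb{H}=\{\alpha-i\beta:\beta>0\}$; $Z$ is (the boundary value of) a conformal map on $\mathbb{H}$, of which only the fact that the extension of $1+W_\alpha=Z_\alpha$ has no zeros in $\mathbb{H}$ is assumed; and the function $W_\alpha/(1+W_\alpha)$ on $\mathbb{R}$ has Fourier transform supported in $(-\infty,0]$, its bounded holomorphic extension to $\mathbb{H}$ being the quotient of the extensions of $W_\alpha$ and $1+W_\alpha$. Crested wave: $W$ is smooth on $\mathbb{R}$ except at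 a nonempty finite set of points, at each of which there is an angular crest. An angular crest of angle $\theta\in(0,\pi)$ at $\alpha_0\in\mathbb{R}$ means that $Z_\alpha\approx C(\alpha-\alpha_0)^{\theta/\pi-1}$ near $\alpha_0$ for some $C\in\mathbb{C}\setminus\{0\}$, i.e. the holomorphic extension satisfies $(z-\alpha_0)^{1-\theta/\pi}\,Z_z(z)\to C$ as $z\to\alpha_0$ in the closed lower half plane, $z\ne\alpha_0$ (with a branch of the power which is holomorphic in the lower half plane and continuous up to $\mathbb{R}\setminus\{\alpha_0\}$). The equation is required to hold at all points of $\mathbb{R}$ other than the crests. *)

theory Defs
  imports "HOL-Complex_Analysis.Complex_Analysis"
begin

text \<open>\<open>C\<^sup>\<infinity>\<close> on an open set \<open>A\<close>: all iterated derivatives exist at the points of \<open>A\<close>.\<close>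

definition smooth_on :: "(real \<Rightarrow> 'a::real_normed_vector) \<Rightarrow> real set \<Rightarrow> bool" where
  "smooth_on f A \<longleftrightarrow>
     (\<forall>n. \<forall>x\<in>A. ((\<lambda>h t. vector_derivative h (at t)) ^^ n) f differentiable (at x))"

section \<open>The homogeneous Besov space\<close>

text \<open>
  \<open>\<psi>\<close> is the symbol of \<open>P\<^sub>0\<close>; the symbol of \<open>P\<^sub>k\<close> is \<open>\<lambda>\<xi>. \<psi> (\<xi> / 2\<^sup>k)\<close>.
\<close>

definition littlewood_paley :: "(real \<Rightarrow> real) \<Rightarrow> bool" where
  "littlewood_paley \<psi> \<longleftrightarrow>
     smooth_on \<psi> UNIV \<and>
     (\<forall>\<xi>. \<psi> \<xi> \<noteq> 0 \<longrightarrow> 1/2 \<le> \<bar>\<xi>\<bar> \<and> \<bar>\<xi>\<bar> \<le> 2) \<and>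
     (\<forall>\<xi>. \<xi> \<noteq> 0 \<longrightarrow> ((\<lambda>k::int. \<psi> (\<xi> / 2 powi k)) has_sum 1) UNIV)"

text \<open>
  The Fourier multiplier \<open>P\<^sub>k\<close> acts on bounded functions, which need not have a Fourier integral,
  as convolution with the inverse Fourier transform of its symbol (a Schwartz function). The
  convention for the Fourier transform is \<open>\<integral> f(x) exp(-i x \<xi>) dx\<close> throughout.
\<close>

definition lp_kernel :: "(real \<Rightarrow> real) \<Rightarrow> int \<Rightarrow> real \<Rightarrow> complex" where
  "lp_kernel \<psi> k x =
     1 / (2 * of_real pi) * (\<integral>\<xi>. of_real (\<psi> (\<xi> / 2 powi k)) * cis (x * \<xi>) \<partial>lborel)"

definition lp_proj :: "(real \<Rightarrow> real) \<Rightarrow> int \<Rightarrow> (real \<Rightarrow> complex) \<Rightarrow> real \<Rightarrow> complex" where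
  "lp_proj \<psi> k u x = (\<integral>y. lp_kernel \<psi> k (x - y) * u y \<partial>lborel)"

definition in_L2 :: "(real \<Rightarrow> complex) \<Rightarrow> bool" where
  "in_L2 f \<longleftrightarrow> f \<in> borel_measurable lborel \<and> integrable lborel (\<lambda>x. (cmod (f x))\<^sup>2)"

definition L2norm :: "(real \<Rightarrow> complex) \<Rightarrow> real" where
  "L2norm f = sqrt (\<integral>x. (cmod (f x))\<^sup>2 \<partial>lborel)"

text \<open>
  The homogeneous Besov space with regularity 1/2 and indices 2, 1, as a space of functions: each element
  is the uniform sum of its dyadic pieces, which excludes nonzero constants.
\<close>

definition besov_half :: "(real \<Rightarrow> real) \<Rightarrow> (real \<Rightarrow> complex) set" where
  "besov_half \<psi> = {u. continuous_on UNIV u \<and> bounded (range u) \<and>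
     (\<forall>k. in_L2 (lp_proj \<psi> k u)) \<and>
     (\<lambda>k::int. 2 powr (of_int k / 2) * L2norm (lp_proj \<psi> k u)) summable_on UNIV \<and>
     uniform_limit UNIV (\<lambda>K x. \<Sum>k\<in>K. lp_proj \<psi> k u x) u (finite_subsets_at_top UNIV)}"

section \<open>Functions with negative frequencies\<close>

text \<open>
  The Fourier transform of the bounded function \<open>u\<close>, as a tempered distribution, is supported in
  \<open>(-\<infinity>, 0]\<close>: it is tested against \<open>\<phi> \<in> C\<^sub>c\<^sup>\<infinity>((0, \<infinity>))\<close>, and pairing the transform of \<open>u\<close> with \<open>\<phi>\<close>
  means pairing \<open>u\<close> with the transform of \<open>\<phi>\<close>.
\<close>

definition fourier_supp_nonpos :: "(real \<Rightarrow> complex) \<Rightarrow> bool" where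
  "fourier_supp_nonpos u \<longleftrightarrow>
     (\<forall>\<phi>::real \<Rightarrow> complex. \<forall>a b. 0 < a \<and> smooth_on \<phi> UNIV \<and> (\<forall>\<xi>. \<phi> \<xi> \<noteq> 0 \<longrightarrow> a \<le> \<xi> \<and> \<xi> \<le> b) \<longrightarrow>
        (\<integral>x. u x * (\<integral>\<xi>. \<phi> \<xi> * cis (- (x * \<xi>)) \<partial>lborel) \<partial>lborel) = 0)"

section \<open>Holomorphic crested waves\<close>

abbreviation lower_half_plane :: "complex set" where
  "lower_half_plane \<equiv> {z. Im z < 0}"

abbreviation closed_lower_half_plane :: "complex set" where
  "closed_lower_half_plane \<equiv> {z. Im z \<le> 0}"

abbreviation d_alpha :: "(real \<Rightarrow> complex) \<Rightarrow> real \<Rightarrow> complex" where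
  "d_alpha W \<alpha> \<equiv> vector_derivative W (at \<alpha>)"

definition R_wave :: "(real \<Rightarrow> complex) \<Rightarrow> real \<Rightarrow> complex" where
  "R_wave W \<alpha> = d_alpha W \<alpha> / (1 + d_alpha W \<alpha>)"

text \<open>
  \<open>U\<close> is the bounded holomorphic extension of \<open>u\<close>, where \<open>u\<close> is only meaningful (and continuous)
  off the finite set \<open>S\<close>. Bounded holomorphic functions are determined by these boundary values.
\<close>

definition bounded_holo_extension ::
    "(complex \<Rightarrow> complex) \<Rightarrow> (real \<Rightarrow> complex) \<Rightarrow> real set \<Rightarrow> bool" where
  "bounded_holo_extension U u S \<longleftrightarrow>
     U holomorphic_on lower_half_plane \<and> bounded (U ` lower_half_plane) \<and>
     (\<forall>\<alpha>. \<alpha> \<notin> S \<longrightarrow> (U \<longlongrightarrow> u \<alpha>) (at (of_real \<alpha>) within lower_half_plane))"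

text \<open>\<open>F\<close> is the holomorphic extension of \<open>W\<close>, and \<open>S\<close> the set of crests.\<close>

definition holomorphic_wave ::
    "(real \<Rightarrow> complex) \<Rightarrow> (complex \<Rightarrow> complex) \<Rightarrow> real set \<Rightarrow> bool" where
  "holomorphic_wave W F S \<longleftrightarrow>
     continuous_on closed_lower_half_plane F \<and>
     F holomorphic_on lower_half_plane \<and>
     (\<forall>\<alpha>. F (of_real \<alpha>) = W \<alpha>) \<and>
     (\<forall>z\<in>lower_half_plane. 1 + deriv F z \<noteq> 0) \<and>
     fourier_supp_nonpos (R_wave W) \<and>
     bounded_holo_extension (\<lambda>z. deriv F z / (1 + deriv F z)) (R_wave W) S"

text \<open>
  The branch of \<open>w\<^sup>a\<close> with \<open>arg w \<in> [-\<pi>, 0]\<close> on the closed lower half plane. The library's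
  \<open>powr\<close> is discontinuous there at the negative reals; rotating by \<open>\<i>\<close> moves its cut away.
  Other branches differ by a constant factor.
\<close>

definition lower_powr :: "complex \<Rightarrow> real \<Rightarrow> complex" where
  "lower_powr w a = exp (of_real a * (Ln (\<i> * w) - \<i> * of_real (pi / 2)))"

definition Z_deriv :: "(real \<Rightarrow> complex) \<Rightarrow> (complex \<Rightarrow> complex) \<Rightarrow> complex \<Rightarrow> complex" where
  "Z_deriv W F z = (if Im z < 0 then 1 + deriv F z else 1 + d_alpha W (Re z))"

definition angular_crest ::
    "(real \<Rightarrow> complex) \<Rightarrow> (complex \<Rightarrow> complex) \<Rightarrow> real \<Rightarrow> real \<Rightarrow> bool" where
  "angular_crest W F \<theta> \<alpha>\<^sub>0 \<longleftrightarrow>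
     (\<exists>C. C \<noteq> 0 \<and>
        ((\<lambda>z. lower_powr (z - of_real \<alpha>\<^sub>0) (1 - \<theta> / pi) * Z_deriv W F z) \<longlongrightarrow> C)
          (at (of_real \<alpha>\<^sub>0) within closed_lower_half_plane))"

definition crested_wave ::
    "(real \<Rightarrow> complex) \<Rightarrow> (complex \<Rightarrow> complex) \<Rightarrow> real set \<Rightarrow> bool" where
  "crested_wave W F S \<longleftrightarrow>
     finite S \<and> S \<noteq> {} \<and> smooth_on W (- S) \<and>
     (\<forall>\<alpha>\<^sub>0\<in>S. \<exists>\<theta>. 0 < \<theta> \<and> \<theta> < pi \<and> angular_crest W F \<theta> \<alpha>\<^sub>0)"

definition wave_equation :: "real \<Rightarrow> real \<Rightarrow> (real \<Rightarrow> complex) \<Rightarrow> real \<Rightarrow> bool" where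
  "wave_equation g c W \<alpha> \<longleftrightarrow>
     2 * of_real g * of_real (Im (W \<alpha>)) =
       of_real (c\<^sup>2) *
         ((d_alpha W \<alpha> + cnj (d_alpha W \<alpha>) + of_real ((cmod (d_alpha W \<alpha>))\<^sup>2)) /
          of_real ((cmod (1 + d_alpha W \<alpha>))\<^sup>2))"

end

theory Submission
  imports Defs "HOL-Probability.Sinc_Integral"
begin

text \<open>
  Put \<open>R = F' / (1 + F')\<close>, so that \<open>1 - R = 1 / Z'\<close>, and let \<open>v = Im W\<close> and \<open>a = c\<^sup>2 / g\<close>. The equation is
  Bernoulli's law \<open>v = a/2 (1 - \<bar>1 - R\<bar>\<^sup>2)\<close> on the real line. At a crest \<open>Z'\<close> is infinite and
  \<open>R = 1\<close>. The proof shows that \<open>R\<close> vanishes identically, so there can be no crest.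

  Differentiating Bernoulli's law along the line gives \<open>(v\<^sup>2)' = a Im (R W')\<close>. Hence, if \<open>G\<close> is a primitive
  of \<open>R\<close> and \<open>K = F - G\<close>, then \<open>K' = R F'\<close> in the half plane and, for a suitable choice of the additive
  constant in \<open>G\<close>, \<open>Im K = v\<^sup>2 / a\<close> on the line. Thus \<open>Im K\<close> is a nonnegative harmonic function. Unless \<open>v = 0\<close>, it can decay no
  faster than \<open>1 / y\<close> at depth \<open>y\<close>, whereas \<open>K'\<close>, being quadratic in the wave, decays too fast for this.

  The decay of \<open>K'\<close> comes from the harmonic function \<open>Re N\<close> with \<open>N = a R + \<i> F\<close>. By Bernoulli's law its boundary
  values are \<open>a/2 \<bar>R\<bar>\<^sup>2 \<ge> 0\<close>. Functions in the Besov space vanish at infinity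
  (\<open>besov_half_vanishing_at_infinity\<close>), hence so do \<open>R\<close>, \<open>v\<close> and \<open>\<bar>R\<bar>\<^sup>2\<close> on the line, and then \<open>R\<close>
  and \<open>Re N\<close> vanish at infinity in the half plane. The gradient estimate for nonnegative harmonic functions
  (\<open>nonneg_Re_gradient_bound\<close>) gives \<open>y N' \<rightarrow> 0\<close>, Cauchy's estimate gives \<open>y R' \<rightarrow> 0\<close>, so
  \<open>y F' \<rightarrow> 0\<close> and \<open>y\<^sup>2 K' \<rightarrow> 0\<close>. Therefore \<open>v = 0\<close> (\<open>half_plane_rigidity\<close>), \<open>Im F = 0\<close> in the half
  plane, and \<open>F' = R = 0\<close>. This also covers \<open>c = 0\<close>, where \<open>v = 0\<close> is the equation itself.

  All comparisons of harmonic functions rest on one maximum principle for functions of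
  sublinear growth (\<open>half_plane_max_principle\<close>); \<open>F\<close> has sublinear growth because \<open>F' = R / (1 - R)\<close>
  tends to 0.
\<close>

section \<open>The maximum principle in the lower half plane\<close>

text \<open>
  Growth and decay in the half plane are measured along this filter. Approaching infinity tangentially
  to the real axis is included, because the arcs of the half discs in Cauchy's theorem reach the axis.
\<close>

abbreviation lower_infinity :: "complex filter" where
  "lower_infinity \<equiv> inf at_infinity (principal lower_half_plane)"

abbreviation sublinear :: "(complex \<Rightarrow> complex) \<Rightarrow> bool" where
  "sublinear f \<equiv> ((\<lambda>w. f w / w) \<longlongrightarrow> 0) lower_infinity"

lemma interior_closed_lower_half_plane: "interior closed_lower_half_plane = lower_half_plane"
  using interior_halfspace_le[of "\<i>" 0] by (simp add: inner_complex_def)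

lemma eventually_lower_infinity:
  "eventually P lower_infinity \<longleftrightarrow> (\<exists>B. \<forall>w. Im w < 0 \<longrightarrow> B \<le> cmod w \<longrightarrow> P w)"
  by (auto simp: eventually_inf_principal eventually_at_infinity)

text \<open>
  The Phragmen-Lindeloef principle. Cauchy's theorem on the half disc of radius \<open>r\<close> is applied to
  \<open>(f w - f z) / ((w - z) (w - cnj z))\<close>, which is regular at \<open>z\<close>. On the diameter the denominator is
  \<open>\<bar>t - z\<bar>\<^sup>2\<close>, so if \<open>Re (f z)\<close> were positive, the integral over the diameter would have a negative real
  part, bounded away from 0 as \<open>r\<close> grows. On the arc the quadratic denominator beats the sublinear
  growth of \<open>f\<close> even after multiplication by the length \<open>\<pi> r\<close>, so that integral tends to 0.
\<close>

lemma half_plane_max_principle: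
  fixes f :: "complex \<Rightarrow> complex"
  assumes cont: "continuous_on closed_lower_half_plane f"
    and holo: "f holomorphic_on lower_half_plane"
    and growth: "sublinear f"
    and bdry: "\<And>t. Re (f (of_real t)) \<le> 0"
    and z: "Im z < 0"
  shows "Re (f z) \<le> 0"
proof (rule ccontr)
  assume "\<not> Re (f z) \<le> 0"
  define m where "m = Re (f z)"
  have m: "m > 0" using \<open>\<not> Re (f z) \<le> 0\<close> by (simp add: m_def)
  \<comment> \<open>Chosen so that the bound \<open>8 * pi * \<epsilon>\<close> for the arc is half of the lower bound for the diameter.\<close>
  define \<epsilon> where "\<epsilon> = m / (8 * pi * (1 + cmod z)\<^sup>2)"
  have nz: "0 < 1 + cmod z" by (simp add: add_pos_nonneg)
  have \<epsilon>: "\<epsilon> > 0" using m nz by (simp add: \<epsilon>_def)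
  have "\<forall>\<^sub>F w in lower_infinity. cmod (f w / w) < \<epsilon>"
    using tendstoD[OF growth \<epsilon>] by simp
  then obtain B where "\<And>w. Im w < 0 \<Longrightarrow> B \<le> cmod w \<Longrightarrow> cmod (f w / w) < \<epsilon>"
    by (auto simp: eventually_lower_infinity)
  then have B: "cmod (f w) \<le> \<epsilon> * cmod w" if "Im w < 0" "B \<le> cmod w" for w
    using \<open>\<And>w. Im w < 0 \<Longrightarrow> B \<le> cmod w \<Longrightarrow> cmod (f w / w) < \<epsilon>\<close>[OF that] that
    by (cases "w = 0") (auto simp: norm_divide pos_divide_less_eq)
  define r where "r = max (2 * cmod z + 1) (max B (cmod (f z) / \<epsilon>))"
  have r1: "r \<ge> 2 * cmod z + 1" and rB: "r \<ge> B" by (auto simp: r_def)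
  have "cmod (f z) / \<epsilon> \<le> r" by (simp add: r_def)
  then have rf: "cmod (f z) \<le> \<epsilon> * r" using \<epsilon> by (simp add: pos_divide_le_eq mult.commute)
  have r0: "r \<ge> 1" using r1 norm_ge_zero[of z] by linarith
  define g where "g = (\<lambda>w. (if w = z then deriv f z else (f w - f z) / (w - z)) / (w - cnj z))"
  have opn: "open {z. Im z < 0}" by (rule open_halfspace_Im_lt)
  have cnjz: "w - cnj z \<noteq> 0" if "Im w \<le> 0" for w
    using that z by (auto simp: complex_eq_iff)
  have fd: "(f has_field_derivative deriv f w) (at w)" if "Im w < 0" for w
    using holo that opn holomorphic_derivI by blast
  have contg: "continuous_on closed_lower_half_plane g"
  proof -
    have "continuous_on closed_lower_half_plane (\<lambda>w. if w = z then deriv f z else (f w - f z) / (w - z))"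
      unfolding continuous_on_def
    proof
      fix w assume w: "w \<in> closed_lower_half_plane"
      show "((\<lambda>w. if w = z then deriv f z else (f w - f z) / (w - z)) \<longlongrightarrow>
              (if w = z then deriv f z else (f w - f z) / (w - z))) (at w within closed_lower_half_plane)"
      proof (cases "w = z")
        case True
        have "((\<lambda>w. (f w - f z) / (w - z)) \<longlongrightarrow> deriv f z) (at z within closed_lower_half_plane)"
          using fd[OF z] has_field_derivative_iff has_field_derivative_at_within by blast
        then have "((\<lambda>w. if w = z then deriv f z else (f w - f z) / (w - z)) \<longlongrightarrow> deriv f z)
             (at z within closed_lower_half_plane)"
          by (rule Lim_transform_eventually) (auto simp: eventually_at_filter)
        then show ?thesis using True by simp
      next
        case False
        have "(f \<longlongrightarrow> f w) (at w within closed_lower_half_plane)"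
          using cont w by (simp add: continuous_on_def)
        then have "((\<lambda>w. (f w - f z) / (w - z)) \<longlongrightarrow> (f w - f z) / (w - z)) (at w within closed_lower_half_plane)"
          using False by (intro tendsto_intros) auto
        moreover have "\<forall>\<^sub>F x in at w within closed_lower_half_plane. x \<noteq> z"
          by (rule tendsto_imp_eventually_ne[OF tendsto_ident_at False])
        ultimately have "((\<lambda>w. if w = z then deriv f z else (f w - f z) / (w - z)) \<longlongrightarrow> (f w - f z) / (w - z))
            (at w within closed_lower_half_plane)"
          by (rule Lim_transform_eventually[OF _ eventually_mono]) simp
        then show ?thesis using False by simp
      qed
    qed
    then show ?thesis unfolding g_def
      by (intro continuous_intros) (use cnjz in auto)
  qed
  have diffg: "g field_differentiable at w" if "w \<in> interior closed_lower_half_plane - {z}" for w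
  proof -
    have w: "Im w < 0" "w \<noteq> z" using that by (auto simp: interior_closed_lower_half_plane)
    have "(\<lambda>w. (f w - f z) / (w - z) / (w - cnj z)) field_differentiable at w"
      using fd[OF w(1)] w cnjz[of w]
      by (intro derivative_intros) (auto simp: field_differentiable_def)
    moreover have "\<forall>\<^sub>F x in nhds w. (f x - f z) / (x - z) / (x - cnj z) = g x"
      using t1_space_nhds[OF w(2)] by eventually_elim (simp add: g_def)
    ultimately show ?thesis
      unfolding field_differentiable_def by (subst (asm) DERIV_cong_ev[OF refl _ refl])
  qed
  define arc where "arc = part_circlepath 0 r pi (2*pi)"
  have arc_pt: "Im w \<le> 0 \<and> cmod w = r \<and> (Im w = 0 \<longrightarrow> w = of_real r \<or> w = of_real (-r))"
    if wa: "w \<in> path_image arc" for w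
  proof -
    obtain s where s: "pi \<le> s" "s \<le> 2*pi" "w = of_real r * exp (\<i> * of_real s)"
      using wa by (auto simp: arc_def path_image_part_circlepath)
    have w: "w = Complex (r * cos s) (r * sin s)"
      using s(3) by (simp add: cis_conv_exp[symmetric] complex_eq_iff)
    have "sin s \<le> 0" using sin_le_zero[of s] s by (cases "s = 2*pi") auto
    then have "r * sin s \<le> 0" using r0 by (simp add: mult_nonneg_nonpos)
    moreover have "cmod w = r" using s(3) r0 by (simp add: norm_mult)
    moreover have "w = of_real r \<or> w = of_real (-r)" if "Im w = 0"
    proof -
      have "\<bar>Re w\<bar> = r" using that \<open>cmod w = r\<close> by (simp add: cmod_def)
      then show ?thesis using that by (auto simp: complex_eq_iff abs_if split: if_splits)
    qed
    ultimately show ?thesis using w by auto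
  qed
  have ends: "pathstart arc = of_real (-r)" "pathfinish arc = of_real r"
    using exp_two_pi_i by (simp_all add: arc_def mult.commute)
  define p where "p = arc +++ linepath (of_real r) (of_real (-r))"
  have "(g has_contour_integral 0) p"
  proof (rule Cauchy_theorem_convex[where K = "{z}", OF contg _ _ diffg])
    show "convex closed_lower_half_plane" by (rule convex_halfspace_Im_le)
    show "valid_path p" using ends by (auto simp: p_def arc_def)
    show "path_image p \<subseteq> closed_lower_half_plane"
      using arc_pt by (auto simp: p_def path_image_join ends closed_segment_def)
    show "pathfinish p = pathstart p" using ends by (simp add: p_def)
  qed auto
  moreover have gl: "g contour_integrable_on linepath (of_real (-r)) (of_real r)"
    by (rule contour_integrable_continuous_linepath, rule continuous_on_subset[OF contg])
       (auto simp: closed_segment_def)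
  moreover have ga: "g contour_integrable_on arc" unfolding arc_def
    by (rule contour_integrable_continuous_part_circlepath, rule continuous_on_subset[OF contg])
       (use arc_pt in \<open>auto simp: arc_def\<close>)
  ultimately have eq: "contour_integral arc g = contour_integral (linepath (of_real (-r)) (of_real r)) g"
  proof -
    assume "(g has_contour_integral 0) p"
    then have "contour_integral p g = 0" by (rule contour_integral_unique)
    moreover have "g contour_integrable_on linepath (of_real r) (of_real (-r))"
      using gl contour_integrable_reversepath_eq[of "linepath (of_real (-r)) (of_real r)" g] by simp
    moreover have "contour_integral (linepath (of_real r) (of_real (-r))) g
        = - contour_integral (linepath (of_real (-r)) (of_real r)) g"
      using contour_integral_reverse_linepath gl
      by (metis (no_types, lifting) contour_integral_reversepath reversepath_linepath valid_path_linepath)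
    ultimately show ?thesis using ga ends
      by (simp add: p_def arc_def)
  qed
  \<comment> \<open>The end points of the arc are left out: there the growth of \<open>f\<close> is not controlled.\<close>
  have arcle: "cmod (contour_integral arc g) \<le> 8 * \<epsilon> / r * r * (2*pi - pi)" 
    unfolding arc_def
  proof (rule has_contour_integral_bound_part_circlepath_strong)
    show "(g has_contour_integral contour_integral (part_circlepath 0 r pi (2 * pi)) g) (part_circlepath 0 r pi (2 * pi))"
      using ga arc_def has_contour_integral_integral by blast
    show "finite {of_real r, of_real (-r) :: complex}" by simp
    show "0 \<le> 8 * \<epsilon> / r" "0 < r" using \<epsilon> r0 by auto
    fix w assume "w \<in> path_image (part_circlepath 0 r pi (2*pi)) - {of_real r, of_real (-r)}"
    then have w: "Im w < 0" "cmod w = r" using arc_pt[of w] by (auto simp: arc_def)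
    have wz: "r / 2 \<le> cmod (w - z)" using norm_triangle_ineq2[of w z] w r1 by linarith
    have wcz: "r / 2 \<le> cmod (w - cnj z)" using norm_triangle_ineq2[of w "cnj z"] w r1 by simp
    have "cmod z < r" using r1 norm_ge_zero[of z] by linarith
    then have "w \<noteq> z" using w by auto
    then have "cmod (g w) = cmod (f w - f z) / cmod (w - z) / cmod (w - cnj z)"
      by (simp add: g_def norm_divide norm_mult)
    also have "\<dots> \<le> (2 * \<epsilon> * r) / (r/2) / (r/2)"
    proof (intro frac_le)
      have "cmod (f w) \<le> \<epsilon> * r" using B[OF w(1)] w rB by simp
      then show "cmod (f w - f z) \<le> 2 * \<epsilon> * r" using norm_triangle_ineq4[of "f w" "f z"] rf by linarith
    qed (use wz wcz r0 \<epsilon> in auto)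
    also have "\<dots> = 8 * \<epsilon> / r" using r0 by (simp add: field_simps)
    finally show "cmod (g w) \<le> 8 * \<epsilon> / r" .
  qed (simp)
  have gi: "((\<lambda>t. g (of_real t)) has_integral contour_integral arc g) {-r..r}"
    using has_contour_integral_integral[OF gl] eq r0
    by (subst (asm) has_contour_integral_linepath_Reals_iff) auto
  have greal: "m / (cmod (of_real t - z))\<^sup>2 \<le> - Re (g (of_real t))" for t
  proof -
    have nz: "of_real t \<noteq> z" using z by auto
    have d: "(of_real t - z) * (of_real t - cnj z) = of_real ((cmod (of_real t - z))\<^sup>2)"
      by (metis complex_cnj_complex_of_real complex_cnj_diff complex_norm_square)
    have "g (of_real t) = (f (of_real t) - f z) / of_real ((cmod (of_real t - z))\<^sup>2)"
      using nz d by (simp add: g_def)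
    then have "- Re (g (of_real t)) = (m - Re (f (of_real t))) / (cmod (of_real t - z))\<^sup>2"
      unfolding m_def by (simp add: minus_divide_left del: of_real_power)
    then show ?thesis using bdry[of t] by (simp add: divide_right_mono)
  qed
  \<comment> \<open>The segment \<open>{-1..1}\<close> alone gives a lower bound that does not depend on \<open>r\<close>.\<close>
  define h where "h = (\<lambda>t. - Re (g (of_real t)))"
  have hi: "(h has_integral - Re (contour_integral arc g)) {-r..r}"
    unfolding h_def using has_integral_linear[OF gi bounded_linear_Re]
    by (intro has_integral_neg) (simp add: o_def)
  have h0: "0 \<le> h t" for t
    unfolding h_def using greal[of t] m by (smt (verit) divide_nonneg_nonneg zero_le_power2)
  have h1: "m / (1 + cmod z)\<^sup>2 \<le> h t" if "t \<in> {-1..1}" for t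
  proof -
    have "cmod (of_real t - z) \<le> 1 + cmod z"
      using order_trans[OF norm_triangle_ineq4[of "of_real t" z]] that by auto
    moreover have "of_real t \<noteq> z" using z by auto
    ultimately have "m / (1 + cmod z)\<^sup>2 \<le> m / (cmod (of_real t - z))\<^sup>2"
      using m by (intro divide_left_mono power_mono mult_pos_pos) auto
    then show ?thesis unfolding h_def using greal[of t] by linarith
  qed
  have hint: "h integrable_on {-r..r}" using hi by blast
  then have hint1: "h integrable_on {-1..1}"
    by (rule integrable_on_subinterval) (use r0 in auto)
  have "2 * (m / (1 + cmod z)\<^sup>2) = integral {-1..1} (\<lambda>t::real. m / (1 + cmod z)\<^sup>2)"
    by simp
  also have "\<dots> \<le> integral {-1..1} h"
    using h1 by (intro integral_le hint1) auto
  also have "\<dots> \<le> integral {-r..r} h"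
    using h0 r0 by (intro integral_subset_le hint hint1) auto
  also have "\<dots> = - Re (contour_integral arc g)" using hi by (rule integral_unique)
  also have "\<dots> \<le> cmod (contour_integral arc g)" using abs_Re_le_cmod[of "contour_integral arc g"] by linarith
  also have "\<dots> \<le> 8 * pi * \<epsilon>" using arcle r0 by (simp add: mult.commute mult.left_commute)
  also have "\<dots> = m / (1 + cmod z)\<^sup>2" by (simp add: \<epsilon>_def)
  finally show False using m nz by (simp add: field_simps)
qed

lemma lower_infinity_at_infinity: "filterlim (\<lambda>w. w) at_infinity lower_infinity"
  by (simp add: filterlim_def le_infI1)

lemma eventually_lower_half_plane: "\<forall>\<^sub>F w in lower_infinity. Im w < 0"
  by (auto simp: eventually_lower_infinity)

lemma bounded_imp_sublinear:
  fixes f :: "complex \<Rightarrow> complex"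
  assumes "\<forall>\<^sub>F w in lower_infinity. cmod (f w) \<le> M"
  shows "sublinear f"
proof -
  have "((\<lambda>w::complex. inverse w) \<longlongrightarrow> 0) lower_infinity"
    by (rule filterlim_compose[OF tendsto_inverse_0 lower_infinity_at_infinity])
  then have "((\<lambda>w. inverse w * f w) \<longlongrightarrow> 0) lower_infinity"
    by (rule lim_null_mult_right_bounded) (rule assms)
  then show ?thesis by (simp add: divide_inverse mult.commute)
qed

text \<open>
  The derivative is integrated along a vertical segment down to the depth \<open>B\<close> and from there, in the
  convex set \<open>Im w \<le> - B\<close>, to a fixed point. The vertical segment avoids the disc where the derivative
  is not small because \<open>\<bar>Re w\<bar> \<ge> B\<close> when \<open>w\<close> is far from 0 and close to the real axis.
\<close>

lemma vanishing_deriv_imp_sublinear: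
  fixes f :: "complex \<Rightarrow> complex"
  assumes holo: "f holomorphic_on lower_half_plane"
    and lim: "(deriv f \<longlongrightarrow> 0) lower_infinity"
  shows "sublinear f"
proof (rule tendstoI)
  fix e :: real assume "0 < e"
  define \<epsilon> where "\<epsilon> = e / 8"
  have \<epsilon>: "0 < \<epsilon>" using \<open>0 < e\<close> by (simp add: \<epsilon>_def)
  have "\<forall>\<^sub>F w in lower_infinity. cmod (deriv f w) < \<epsilon>"
    using tendstoD[OF lim \<epsilon>] by simp
  then obtain B0 where B0: "\<And>w. Im w < 0 \<Longrightarrow> B0 \<le> cmod w \<Longrightarrow> cmod (deriv f w) \<le> \<epsilon>"
    by (auto simp: eventually_lower_infinity intro: less_imp_le)
  define B where "B = max B0 1"
  have B: "1 \<le> B" "\<And>w. Im w < 0 \<Longrightarrow> B \<le> cmod w \<Longrightarrow> cmod (deriv f w) \<le> \<epsilon>"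
    using B0 by (auto simp: B_def)
  have fd: "(f has_field_derivative deriv f w) (at w within A)" if "Im w < 0" for w A
    using holomorphic_derivI[OF holo open_halfspace_Im_lt] that by blast
  define p where "p = Complex 0 (- B)"
  define M where "M = cmod (f p)"
  have deep: "cmod (f w) \<le> M + \<epsilon> * (cmod w + B)" if w: "Im w \<le> - B" for w
  proof -
    have "cmod (f w - f p) \<le> \<epsilon> * cmod (w - p)"
    proof (rule field_differentiable_bound[where S = "{z. Im z \<le> - B}" and f' = "deriv f"])
      show "convex {z. Im z \<le> - B}" by (rule convex_halfspace_Im_le)
      fix z assume z: "z \<in> {z. Im z \<le> - B}"
      then have "Im z < 0" using B(1) by simp
      moreover have "B \<le> cmod z" using z abs_Im_le_cmod[of z] by simp
      ultimately show "cmod (deriv f z) \<le> \<epsilon>" using B(2) by blast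
      show "(f has_field_derivative deriv f z) (at z within {z. Im z \<le> - B})"
        using fd \<open>Im z < 0\<close> by blast
    qed (use w in \<open>auto simp: p_def\<close>)
    also have "\<dots> \<le> \<epsilon> * (cmod w + B)"
    proof -
      have "cmod p = B" using B(1) by (simp add: p_def cmod_def)
      then show ?thesis using \<epsilon> norm_triangle_ineq4[of w p] by simp
    qed
    finally show ?thesis unfolding M_def using norm_triangle_ineq2[of "f w" "f p"] by linarith
  qed
  have all: "cmod (f w) \<le> M + \<epsilon> * (cmod w + 3 * B)" if w: "Im w < 0" "2 * B \<le> cmod w" for w
  proof (cases "Im w \<le> - B")
    case True
    then have "cmod (f w) \<le> M + \<epsilon> * (cmod w + B)" by (rule deep)
    also have "\<dots> \<le> M + \<epsilon> * (cmod w + 3 * B)" using \<epsilon> B(1) by simp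
    finally show ?thesis .
  next
    case False
    define q where "q = Complex (Re w) (- B)"
    have Re: "B \<le> \<bar>Re w\<bar>" using w False cmod_le[of w] by auto
    have "cmod (f w - f q) \<le> \<epsilon> * cmod (w - q)"
    proof (rule field_differentiable_bound[where S = "{z. Re z = Re w} \<inter> {z. Im z < 0}" and f' = "deriv f"])
      have "convex {z. Re z = Re w}"
        using convex_hyperplane[of "1::complex" "Re w"] by (simp add: inner_complex_def)
      then show "convex ({z. Re z = Re w} \<inter> {z. Im z < 0})"
        by (intro convex_Int convex_halfspace_Im_lt)
      fix z assume z: "z \<in> {z. Re z = Re w} \<inter> {z. Im z < 0}"
      then have "B \<le> cmod z" using Re abs_Re_le_cmod[of z] by simp
      then show "cmod (deriv f z) \<le> \<epsilon>" using B(2) z by blast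
      show "(f has_field_derivative deriv f z) (at z within {z. Re z = Re w} \<inter> {z. Im z < 0})"
        using fd z by blast
    qed (use w B(1) in \<open>auto simp: q_def\<close>)
    moreover have "cmod (w - q) \<le> B" using cmod_le[of "w - q"] False w by (simp add: q_def)
    then have "\<epsilon> * cmod (w - q) \<le> \<epsilon> * B" using \<epsilon> by simp
    moreover have "cmod (f q) \<le> M + \<epsilon> * (cmod q + B)" by (rule deep) (simp add: q_def)
    moreover have "cmod q \<le> cmod w + B"
    proof -
      have "cmod q \<le> \<bar>Re w\<bar> + B" using cmod_le[of q] B(1) by (simp add: q_def)
      then show ?thesis using abs_Re_le_cmod[of w] by linarith
    qed
    then have "\<epsilon> * (cmod q + B) \<le> \<epsilon> * (cmod w + 2 * B)" using \<epsilon> by simp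
    moreover have "\<epsilon> * B + \<epsilon> * (cmod w + 2 * B) = \<epsilon> * (cmod w + 3 * B)" by (simp add: algebra_simps)
    ultimately show ?thesis using norm_triangle_ineq2[of "f w" "f q"] by linarith
  qed
  show "\<forall>\<^sub>F w in lower_infinity. dist (f w / w) 0 < e"
    unfolding eventually_lower_infinity
  proof (intro exI allI impI)
    fix w assume w: "Im w < 0" and large: "max (2 * B) (M / \<epsilon>) \<le> cmod w"
    have w0: "cmod w > 0" using w by auto
    have "cmod (f w) \<le> M + \<epsilon> * (cmod w + 3 * B)" using all w large by simp
    also have "M \<le> \<epsilon> * cmod w" using large \<epsilon> by (simp add: pos_divide_le_eq mult.commute)
    also have "\<epsilon> * (cmod w + 3 * B) \<le> \<epsilon> * (3 * cmod w)"
    proof -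
      have "2 * B \<le> cmod w" using large by simp
      then have "3 * B \<le> 2 * cmod w" using w0 by linarith
      then show ?thesis using \<epsilon> by simp
    qed
    finally have "cmod (f w) \<le> 4 * \<epsilon> * cmod w" by simp
    also have "\<dots> < e * cmod w" using w0 \<open>0 < e\<close> by (simp add: \<epsilon>_def)
    finally show "dist (f w / w) 0 < e" using w0 by (simp add: norm_divide pos_divide_less_eq)
  qed
qed

section \<open>Comparison with Poisson kernels\<close>

text \<open>
  A holomorphic function on the half plane whose real part is, up to the factor \<open>\<pi>\<close>, the Poisson kernel
  with pole \<open>b + \<i> s\<close> in the upper half plane. Its explicit boundary values make it a barrier for
  comparison arguments, in place of Poisson integrals.
\<close>

abbreviation Poisson_kernel :: "real \<Rightarrow> real \<Rightarrow> complex \<Rightarrow> complex" where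
  "Poisson_kernel b s z \<equiv> - \<i> / (z - (of_real b + \<i> * of_real s))"

lemma Poisson_kernel_real_axis:
  "Re (Poisson_kernel b s (of_real t)) = s / ((t - b)\<^sup>2 + s\<^sup>2)"
  by (simp add: Re_divide power2_eq_square)

lemma Poisson_kernel_bound:
  assumes "0 < s" "Im z \<le> 0"
  shows "cmod (Poisson_kernel b s z) \<le> 1 / s"
proof -
  have "s \<le> cmod (z - (of_real b + \<i> * of_real s))"
    using abs_Im_le_cmod[of "z - (of_real b + \<i> * of_real s)"] assms by simp
  then show ?thesis using assms by (simp add: norm_divide frac_le)
qed

lemma Poisson_kernel_holomorphic:
  assumes "0 < s"
  shows "continuous_on closed_lower_half_plane (\<lambda>z. Poisson_kernel b s z)"
    and "(\<lambda>z. Poisson_kernel b s z) holomorphic_on lower_half_plane"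
proof -
  have "z - (of_real b + \<i> * of_real s) \<noteq> 0" if "Im z \<le> 0" for z
    using that assms by (auto simp: complex_eq_iff)
  then show "continuous_on closed_lower_half_plane (\<lambda>z. Poisson_kernel b s z)"
    and "(\<lambda>z. Poisson_kernel b s z) holomorphic_on lower_half_plane"
    by (auto intro!: continuous_intros holomorphic_intros)
qed

lemma Poisson_kernel_sublinear:
  assumes "0 < s"
  shows "((\<lambda>z. Poisson_kernel b s z / z) \<longlongrightarrow> 0) lower_infinity"
  by (rule bounded_imp_sublinear[where M = "1 / s"], rule eventually_mono[OF eventually_lower_half_plane])
     (use Poisson_kernel_bound assms in auto)

lemma vanishing_at_infinity_majorant:
  fixes h :: "real \<Rightarrow> real"
  assumes cont: "continuous_on UNIV h" and lim: "(h \<longlongrightarrow> 0) at_infinity" and "0 < \<epsilon>"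
  obtains C where "0 \<le> C" "\<And>t. h t \<le> \<epsilon> + C * (1 / (t\<^sup>2 + 1))"
proof -
  obtain A where A: "\<And>t. A \<le> \<bar>t\<bar> \<Longrightarrow> \<bar>h t\<bar> < \<epsilon>"
    using tendstoD[OF lim \<open>0 < \<epsilon>\<close>] by (auto simp: eventually_at_infinity)
  have "bounded (h ` {-\<bar>A\<bar>..\<bar>A\<bar>})"
    by (intro compact_imp_bounded compact_continuous_image continuous_on_subset[OF cont]) auto
  then obtain M where M: "0 < M" "\<And>t. t \<in> {-\<bar>A\<bar>..\<bar>A\<bar>} \<Longrightarrow> \<bar>h t\<bar> \<le> M"
    by (auto simp: bounded_pos)
  show ?thesis
  proof
    show "0 \<le> M * (A\<^sup>2 + 1)" using M(1) by simp
    fix t :: real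
    have p: "0 < t\<^sup>2 + 1" by (simp add: add_nonneg_pos)
    show "h t \<le> \<epsilon> + M * (A\<^sup>2 + 1) * (1 / (t\<^sup>2 + 1))"
    proof (cases "A \<le> \<bar>t\<bar>")
      case True
      then have "h t \<le> \<epsilon>" using A[of t] by auto
      moreover have "0 \<le> M * (A\<^sup>2 + 1) * (1 / (t\<^sup>2 + 1))" using M(1) p by simp
      ultimately show ?thesis by linarith
    next
      case False
      then have "\<bar>t\<bar> \<le> \<bar>A\<bar>" by linarith
      then have "t\<^sup>2 \<le> A\<^sup>2" by (simp add: abs_le_square_iff)
      then have "1 \<le> (A\<^sup>2 + 1) * (1 / (t\<^sup>2 + 1))" using p by simp
      then have "M * 1 \<le> M * ((A\<^sup>2 + 1) * (1 / (t\<^sup>2 + 1)))" using M(1) by (intro mult_left_mono) auto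
      moreover have "t \<in> {-\<bar>A\<bar>..\<bar>A\<bar>}" using \<open>\<bar>t\<bar> \<le> \<bar>A\<bar>\<close> unfolding atLeastAtMost_iff by linarith
      then have "h t \<le> M" using M(2)[of t] by linarith
      then have "h t \<le> M * ((A\<^sup>2 + 1) * (1 / (t\<^sup>2 + 1)))"
        using \<open>M * 1 \<le> M * ((A\<^sup>2 + 1) * (1 / (t\<^sup>2 + 1)))\<close> by linarith
      then show ?thesis using \<open>0 < \<epsilon>\<close> by (simp add: mult.assoc)
    qed
  qed
qed

lemma half_plane_comparison:
  fixes f g :: "complex \<Rightarrow> complex"
  assumes "continuous_on closed_lower_half_plane f" "f holomorphic_on lower_half_plane"
    and "sublinear f"
    and "continuous_on closed_lower_half_plane g" "g holomorphic_on lower_half_plane"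
    and "sublinear g"
    and "\<And>t. Re (f (of_real t)) \<le> Re (g (of_real t))" and "Im z < 0"
  shows "Re (f z) \<le> Re (g z)"
proof -
  have "Re (f z - g z) \<le> 0"
  proof (rule half_plane_max_principle[where f = "\<lambda>z. f z - g z"])
    show "((\<lambda>w. (f w - g w) / w) \<longlongrightarrow> 0) lower_infinity"
      using tendsto_diff[OF assms(3,6)] by (simp add: diff_divide_distrib)
  qed (use assms in \<open>auto intro!: continuous_intros holomorphic_intros\<close>)
  then show ?thesis by simp
qed

lemma half_plane_nonneg:
  fixes f :: "complex \<Rightarrow> complex"
  assumes "continuous_on closed_lower_half_plane f" "f holomorphic_on lower_half_plane"
    and "sublinear f"
    and "\<And>t. 0 \<le> Re (f (of_real t))" and "Im z < 0"
  shows "0 \<le> Re (f z)"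
  using half_plane_comparison[of "\<lambda>_. 0" f z] assms by simp

text \<open>
  Boundary values that vanish at infinity are at most \<open>e/2 + C / (1 + t\<^sup>2)\<close>. This majorant is the boundary
  value of a constant plus a multiple of \<^term>\<open>Poisson_kernel 0 1\<close>, which tends to 0 at infinity.
\<close>

lemma half_plane_upper_vanishing:
  fixes f :: "complex \<Rightarrow> complex"
  assumes f: "continuous_on closed_lower_half_plane f" "f holomorphic_on lower_half_plane"
      "sublinear f"
    and lim: "((\<lambda>t. Re (f (of_real t))) \<longlongrightarrow> 0) at_infinity" and "0 < e"
  shows "\<forall>\<^sub>F z in lower_infinity. Re (f z) < e"
proof -
  have "continuous_on UNIV (\<lambda>t. Re (f (of_real t)))"
    by (intro continuous_intros continuous_on_compose2[OF f(1)]) auto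
  then obtain C where C: "0 \<le> C" "\<And>t. Re (f (of_real t)) \<le> e / 2 + C * (1 / (t\<^sup>2 + 1))"
    using vanishing_at_infinity_majorant[OF _ lim, of "e / 2"] \<open>0 < e\<close> by auto
  define k where "k = (\<lambda>z. Poisson_kernel 0 1 z)"
  note kernel = Poisson_kernel_holomorphic[of 1 0, folded k_def] Poisson_kernel_sublinear[of 1 0, folded k_def]
  have le: "Re (f z) \<le> e / 2 + C * Re (k z)" if "Im z < 0" for z
  proof -
    have "Re (f z) \<le> Re (of_real (e / 2) + of_real C * k z)"
    proof (rule half_plane_comparison[OF f])
      show "continuous_on closed_lower_half_plane (\<lambda>z. of_real (e / 2) + of_real C * k z)"
        by (intro continuous_intros kernel) simp
      show "(\<lambda>z. of_real (e / 2) + of_real C * k z) holomorphic_on lower_half_plane"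
        by (intro holomorphic_intros kernel) simp
      show "((\<lambda>w. (of_real (e / 2) + of_real C * k w) / w) \<longlongrightarrow> 0) lower_infinity"
      proof (rule bounded_imp_sublinear[where M = "e / 2 + C * 1"], rule eventually_mono[OF eventually_lower_half_plane])
        fix w :: complex assume "Im w < 0"
        then have "cmod (k w) \<le> 1" using Poisson_kernel_bound[of 1 w 0] by (simp add: k_def)
        then have "cmod (of_real C * k w) \<le> C * 1" using C(1) by (simp add: norm_mult mult_left_le)
        then show "cmod (of_real (e / 2) + of_real C * k w) \<le> e / 2 + C * 1"
          using norm_triangle_ineq[of "of_real (e / 2)" "of_real C * k w"] \<open>0 < e\<close> by simp
      qed
      show "Re (f (of_real t)) \<le> Re (of_real (e / 2) + of_real C * k (of_real t))" for t
      proof -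
        have "Re (k (of_real t)) = 1 / (t\<^sup>2 + 1)"
          using Poisson_kernel_real_axis[of t 0 1] by (simp add: k_def)
        then show ?thesis using C(2)[of t] by simp
      qed
    qed (use that in auto)
    then show ?thesis by simp
  qed
  have "filterlim (\<lambda>z::complex. z - \<i>) at_infinity lower_infinity"
    using tendsto_add_filterlim_at_infinity'[OF lower_infinity_at_infinity tendsto_const[of "- \<i>"]] by simp
  then have "(k \<longlongrightarrow> 0) lower_infinity"
    unfolding k_def by (intro tendsto_divide_0[OF tendsto_const]) simp
  then have "((\<lambda>z. e / 2 + C * Re (k z)) \<longlongrightarrow> e / 2 + C * Re 0) lower_infinity"
    by (intro tendsto_intros)
  then have "\<forall>\<^sub>F z in lower_infinity. e / 2 + C * Re (k z) < e"
    by (rule order_tendstoD) (use \<open>0 < e\<close> in simp)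
  with eventually_lower_half_plane show ?thesis
    by eventually_elim (use le in fastforce)
qed

lemma half_plane_vanishing_Re:
  fixes f :: "complex \<Rightarrow> complex"
  assumes f: "continuous_on closed_lower_half_plane f" "f holomorphic_on lower_half_plane"
      "sublinear f"
    and lim: "((\<lambda>t. Re (f (of_real t))) \<longlongrightarrow> 0) at_infinity"
  shows "((\<lambda>z. Re (f z)) \<longlongrightarrow> 0) lower_infinity"
proof (rule tendstoI)
  fix e :: real assume "0 < e"
  have "\<forall>\<^sub>F z in lower_infinity. Re (f z) < e"
    by (rule half_plane_upper_vanishing[OF f lim \<open>0 < e\<close>])
  moreover have "\<forall>\<^sub>F z in lower_infinity. Re (- f z) < e"
    by (rule half_plane_upper_vanishing[where f = "\<lambda>z. - f z"])
       (use f tendsto_minus[OF f(3)] tendsto_minus[OF lim] \<open>0 < e\<close> in \<open>auto intro!: continuous_intros holomorphic_intros\<close>)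
  ultimately show "\<forall>\<^sub>F z in lower_infinity. dist (Re (f z)) 0 < e"
    by eventually_elim (simp add: abs_less_iff)
qed

lemma half_plane_vanishing:
  fixes f :: "complex \<Rightarrow> complex"
  assumes f: "continuous_on closed_lower_half_plane f" "f holomorphic_on lower_half_plane"
      "sublinear f"
    and lim: "((\<lambda>t. f (of_real t)) \<longlongrightarrow> 0) at_infinity"
  shows "(f \<longlongrightarrow> 0) lower_infinity"
proof -
  have "((\<lambda>z. Re (f z)) \<longlongrightarrow> 0) lower_infinity"
    using half_plane_vanishing_Re[OF f] tendsto_Re[OF lim] by simp
  moreover have "((\<lambda>z. Re (- \<i> * f z)) \<longlongrightarrow> 0) lower_infinity"
  proof (rule half_plane_vanishing_Re)
    show "((\<lambda>w. - \<i> * f w / w) \<longlongrightarrow> 0) lower_infinity"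
      using tendsto_mult_right_zero[OF f(3), of "- \<i>"] by simp
    show "((\<lambda>t. Re (- \<i> * f (of_real t))) \<longlongrightarrow> 0) at_infinity"
      using tendsto_Im[OF lim] by simp
  qed (use f in \<open>auto intro!: continuous_intros holomorphic_intros\<close>)
  ultimately show ?thesis
    by (simp add: tendsto_complex_iff)
qed

text \<open>
  A quantitative Hopf lemma at infinity: a nonnegative harmonic function with nonzero boundary values
  decays at most like \<open>1 / y\<close> along vertical lines, as its Poisson integral does. The minorant is the
  kernel with pole at height \<open>s\<close> minus a weight times the kernel with pole at height \<open>2 s\<close>: far out on the line it behaves
  like \<open>s / t\<^sup>2\<close> times 1 minus twice the weight, while its total mass is proportional to 1 minus
  the weight. With the weight \<open>3/4\<close> it is negative away from \<open>b\<close> and still has positive mass.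
\<close>

lemma half_plane_lower_bound:
  fixes f :: "complex \<Rightarrow> complex"
  assumes f: "continuous_on closed_lower_half_plane f" "f holomorphic_on lower_half_plane"
      "sublinear f"
    and nonneg: "\<And>t. 0 \<le> Re (f (of_real t))" and pos: "0 < Re (f (of_real b))"
  obtains c where "0 < c" "\<forall>\<^sub>F y in at_top. c / y \<le> Re (f (Complex b (- y)))"
proof -
  have "continuous_on UNIV (\<lambda>t. Re (f (of_real t)))"
    by (intro continuous_intros continuous_on_compose2[OF f(1)]) auto
  then have "isCont (\<lambda>t. Re (f (of_real t))) b" by (simp add: continuous_on_eq_continuous_at)
  define \<eta> where "\<eta> = Re (f (of_real b)) / 2"
  have \<eta>: "0 < \<eta>" using pos by (simp add: \<eta>_def)
  obtain d where d: "0 < d" "\<And>t. \<bar>t - b\<bar> < d \<Longrightarrow> \<eta> \<le> Re (f (of_real t))"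
  proof -
    have "\<forall>\<^sub>F t in at b. dist (Re (f (of_real t))) (Re (f (of_real b))) < \<eta>"
      using \<open>isCont _ b\<close> \<eta> unfolding isCont_def by (rule tendstoD)
    then obtain d where d: "0 < d"
      "\<And>t. t \<noteq> b \<Longrightarrow> dist t b < d \<Longrightarrow> dist (Re (f (of_real t))) (Re (f (of_real b))) < \<eta>"
      unfolding eventually_at by auto
    have "\<eta> \<le> Re (f (of_real t))" if "\<bar>t - b\<bar> < d" for t
    proof (cases "t = b")
      case False
      then have "\<bar>Re (f (of_real t)) - Re (f (of_real b))\<bar> < \<eta>"
        using d(2)[of t] that by (simp add: dist_real_def)
      then show ?thesis unfolding \<eta>_def by linarith
    qed (use pos in \<open>simp add: \<eta>_def\<close>)
    then show ?thesis using that d(1) by blast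
  qed
  \<comment> \<open>The minorant is nonpositive where \<open>(t - b)\<^sup>2 \<ge> 5 s\<^sup>2\<close>, in particular where \<open>\<bar>t - b\<bar> \<ge> 3 s\<close>.\<close>
  define s where "s = d / 3"
  have s: "0 < s" using d by (simp add: s_def)
  define k where "k = (\<lambda>\<sigma> z. Poisson_kernel b \<sigma> z)"
  have kernel: "continuous_on closed_lower_half_plane (k \<sigma>)" "k \<sigma> holomorphic_on lower_half_plane"
    "((\<lambda>z. k \<sigma> z / z) \<longlongrightarrow> 0) lower_infinity" if "0 < \<sigma>" for \<sigma>
    unfolding k_def using that by (fact Poisson_kernel_holomorphic Poisson_kernel_sublinear)+
  define g where "g = (\<lambda>z. of_real (\<eta> * s) * (k s z - of_real (3/4) * k (2 * s) z))"
  have g_Re: "Re (g z) = \<eta> * s * (Re (k s z) - 3/4 * Re (k (2 * s) z))" for z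
  proof -
    have "Re (of_real (\<eta> * s) * (k s z - of_real l * k (2 * s) z)) = \<eta> * s * (Re (k s z) - l * Re (k (2 * s) z))" for l
      by (simp add: algebra_simps)
    then show ?thesis unfolding g_def .
  qed
  have bdry: "Re (g (of_real t)) \<le> Re (f (of_real t))" for t
  proof -
    define x where "x = (t - b)\<^sup>2"
    have x: "0 \<le> x" by (simp add: x_def)
    have "Re (g (of_real t)) = \<eta> * s * (s / (x + s\<^sup>2) - 3/4 * (2 * s / (x + (2 * s)\<^sup>2)))"
      using Poisson_kernel_real_axis[of t b s]
        Poisson_kernel_real_axis[of t b "2 * s"] s
      unfolding g_Re x_def by (simp only: mult_pos_pos zero_less_numeral k_def)
    also have "\<dots> \<le> Re (f (of_real t))"
    proof (cases "\<bar>t - b\<bar> < d")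
      case True
      have "s / (x + s\<^sup>2) \<le> s / s\<^sup>2" using s x by (intro divide_left_mono mult_pos_pos add_nonneg_pos) auto
      moreover have "0 \<le> 3/4 * (2 * s / (x + (2 * s)\<^sup>2))" using s x by simp
      ultimately have "s / (x + s\<^sup>2) - 3/4 * (2 * s / (x + (2 * s)\<^sup>2)) \<le> 1 / s"
        using s by (simp add: power2_eq_square)
      then have "\<eta> * s * (s / (x + s\<^sup>2) - 3/4 * (2 * s / (x + (2 * s)\<^sup>2))) \<le> \<eta> * s * (1 / s)"
        using \<eta> s by (intro mult_left_mono) auto
      also have "\<dots> = \<eta>" using s by simp
      finally show ?thesis using d(2)[OF True] by linarith
    next
      case False
      then have "(3 * s)\<^sup>2 \<le> x" unfolding x_def s_def using d(1) by (simp add: abs_le_square_iff[symmetric])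
      then have "9 * s\<^sup>2 \<le> x" by (simp add: power_mult_distrib)
      then have "s / (x + s\<^sup>2) \<le> 3/4 * (2 * s / (x + (2 * s)\<^sup>2))"
      proof -
        have "0 < s\<^sup>2" using s by simp
        have "s / (x + s\<^sup>2) \<le> s / (2/3 * (x + (2 * s)\<^sup>2))"
        proof (intro divide_left_mono mult_pos_pos add_nonneg_pos)
          have "5 * s\<^sup>2 \<le> x" using \<open>9 * s\<^sup>2 \<le> x\<close> \<open>0 < s\<^sup>2\<close> by linarith
          then show "2/3 * (x + (2 * s)\<^sup>2) \<le> x + s\<^sup>2" by (simp add: power_mult_distrib)
        qed (use s x in auto)
        then show ?thesis by (simp add: mult.commute)
      qed
      then have "\<eta> * s * (s / (x + s\<^sup>2) - 3/4 * (2 * s / (x + (2 * s)\<^sup>2))) \<le> 0"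
        using \<eta> s by (intro mult_nonneg_nonpos) auto
      then show ?thesis using nonneg[of t] by linarith
    qed
    finally show ?thesis .
  qed
  have le: "Re (g z) \<le> Re (f z)" if "Im z < 0" for z
  proof (rule half_plane_comparison[OF _ _ _ f bdry that])
    show "continuous_on closed_lower_half_plane g" unfolding g_def
      by (intro continuous_intros kernel) (use s in auto)
    show "g holomorphic_on lower_half_plane" unfolding g_def
      by (intro holomorphic_intros kernel) (use s in auto)
    have "((\<lambda>w. of_real (\<eta> * s) * (k s w / w - of_real (3/4) * (k (2 * s) w / w))) \<longlongrightarrow>
        of_real (\<eta> * s) * (0 - of_real (3/4) * 0)) lower_infinity"
      by (intro tendsto_intros kernel) (use s in auto)
    moreover have "g w / w = of_real (\<eta> * s) * (k s w / w - of_real (3/4) * (k (2 * s) w / w))" for w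
      by (cases "w = 0") (simp_all add: g_def field_simps)
    ultimately show "sublinear g"
      by (simp only: mult_zero_right diff_zero)
  qed
  show thesis
  proof
    show "0 < \<eta> * s / 8" using \<eta> s by simp
    show "\<forall>\<^sub>F y in at_top. \<eta> * s / 8 / y \<le> Re (f (Complex b (- y)))"
      using eventually_ge_at_top[of s]
    proof eventually_elim
      case (elim y)
      have y: "0 < y" using s elim by linarith
      have k: "Re (k \<sigma> (Complex b (- y))) = 1 / (y + \<sigma>)" if "0 < \<sigma>" for \<sigma>
        using that y by (simp add: k_def Re_divide power2_eq_square divide_simps)
      have "1 / (y + 2 * s) \<le> 1 / (y + s)" "1 / (2 * y) \<le> 1 / (y + s)"
        using y s elim by (auto intro!: divide_left_mono)
      moreover have "1 / (8 * y) = 1/4 * (1 / (2 * y))" by simp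
      ultimately have "1 / (8 * y) \<le> 1 / (y + s) - 3/4 * (1 / (y + 2 * s))" by argo
      then have "\<eta> * s * (1 / (8 * y)) \<le> \<eta> * s * (1 / (y + s) - 3/4 * (1 / (y + 2 * s)))"
        using \<eta> s by (intro mult_left_mono) auto
      also have "\<dots> = Re (g (Complex b (- y)))" using k[of s] k[of "2 * s"] s by (simp add: g_Re)
      also have "\<dots> \<le> Re (f (Complex b (- y)))" using y by (intro le) simp
      finally show ?case by simp
    qed
  qed
qed

section \<open>Derivatives of harmonic functions\<close>

lemma cball_in_lower_half_plane:
  assumes "Im z < 0" and "w \<in> cball z (- Im z / 2)"
  shows "Im w < 0" and "cmod z \<le> 2 * cmod w"
proof -
  have d: "cmod (z - w) \<le> - Im z / 2" using assms by (simp add: dist_norm)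
  then show "Im w < 0" using abs_Im_le_cmod[of "z - w"] assms by simp
  show "cmod z \<le> 2 * cmod w"
    using d abs_Im_le_cmod[of z] norm_triangle_ineq2[of z w] by simp
qed

text \<open>
  Cauchy's estimate on the disc around \<open>z\<close> whose radius is half of the distance to the real axis. All
  points of this disc are at least half as far from 0 as \<open>z\<close>, so they go to infinity with \<open>z\<close>, even
  tangentially.
\<close>

lemma vanishing_imp_deriv_decay:
  fixes f :: "complex \<Rightarrow> complex"
  assumes holo: "f holomorphic_on lower_half_plane" and lim: "(f \<longlongrightarrow> 0) lower_infinity"
  shows "((\<lambda>z. of_real (Im z) * deriv f z) \<longlongrightarrow> 0) lower_infinity"
proof (rule tendstoI)
  fix e :: real assume "0 < e"
  have "\<forall>\<^sub>F w in lower_infinity. cmod (f w) < e / 4"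
    using tendstoD[OF lim, of "e / 4"] \<open>0 < e\<close> by simp
  then obtain B where B: "\<And>w. Im w < 0 \<Longrightarrow> B \<le> cmod w \<Longrightarrow> cmod (f w) \<le> e / 4"
    by (auto simp: eventually_lower_infinity intro: less_imp_le)
  show "\<forall>\<^sub>F z in lower_infinity. dist (of_real (Im z) * deriv f z) 0 < e"
    unfolding eventually_lower_infinity
  proof (intro exI allI impI)
    fix z assume z: "Im z < 0" "2 * B \<le> cmod z"
    define r where "r = - Im z / 2"
    have r: "0 < r" using z by (simp add: r_def)
    have sub: "cball z r \<subseteq> lower_half_plane"
      using cball_in_lower_half_plane(1)[OF z(1)] by (auto simp: r_def)
    have "cmod ((deriv ^^ 1) f z) \<le> fact 1 * (e / 4) / r ^ 1"
    proof (rule Cauchy_inequality[OF _ _ r])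
      show "f holomorphic_on ball z r"
        using holo by (rule holomorphic_on_subset) (use sub ball_subset_cball in blast)
      show "continuous_on (cball z r) f"
        using holomorphic_on_imp_continuous_on[OF holo] sub by (rule continuous_on_subset)
      fix w assume "cmod (z - w) = r"
      then have w: "w \<in> cball z (- Im z / 2)" by (simp add: dist_norm r_def)
      show "cmod (f w) \<le> e / 4"
        using B[OF cball_in_lower_half_plane(1)[OF z(1) w]] cball_in_lower_half_plane(2)[OF z(1) w] z(2) by simp
    qed
    then have "cmod (deriv f z) * (2 * r) \<le> e / 2" using r by (simp add: field_simps)
    then have "cmod (of_real (Im z) * deriv f z) \<le> e / 2" using r by (simp add: norm_mult r_def mult.commute)
    then show "dist (of_real (Im z) * deriv f z) 0 < e" using \<open>0 < e\<close> by simp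
  qed
qed

text \<open>
  The Cayley transform \<open>(f w - f z) / (f w + cnj (f z))\<close> maps the right half plane to the unit disc, so
  Cauchy's estimate bounds its derivative at \<open>z\<close>, which is \<open>f' z / (2 Re (f z))\<close>. The real part
  is made strictly positive by adding a small constant. Since \<open>Re (f z)\<close> appears on the right, smallness of the real
  part alone makes the whole derivative small.
\<close>

lemma nonneg_Re_gradient_bound:
  fixes f :: "complex \<Rightarrow> complex"
  assumes holo: "f holomorphic_on A" and "open A" and r: "0 < r" and sub: "cball z r \<subseteq> A"
    and nonneg: "\<And>w. w \<in> cball z r \<Longrightarrow> 0 \<le> Re (f w)"
  shows "cmod (deriv f z) \<le> 2 * Re (f z) / r"
proof (rule field_le_epsilon)
  fix e :: real assume e: "0 < e"
  define \<epsilon> where "\<epsilon> = e * r / 2"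
  have \<epsilon>: "0 < \<epsilon>" using e r by (simp add: \<epsilon>_def)
  define p where "p = (\<lambda>w. f w + of_real \<epsilon>)"
  have p_pos: "0 < Re (p w)" if "w \<in> cball z r" for w
    using nonneg[OF that] \<epsilon> by (simp add: p_def)
  have zz: "z \<in> cball z r" using r by simp
  define \<phi> where "\<phi> = (\<lambda>w. (p w - p z) / (p w + cnj (p z)))"
  have nz: "p w + cnj (p z) \<noteq> 0" if "w \<in> cball z r" for w
    using p_pos[OF that] p_pos[OF zz] by (auto simp: complex_eq_iff)
  have holop: "p holomorphic_on A" unfolding p_def by (intro holomorphic_intros holo)
  have "\<phi> holomorphic_on cball z r"
    unfolding \<phi>_def by (intro holomorphic_intros holomorphic_on_subset[OF holop sub] nz)
  then have "cmod ((deriv ^^ 1) \<phi> z) \<le> fact 1 * 1 / r ^ 1"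
  proof (intro Cauchy_inequality r)
    assume h: "\<phi> holomorphic_on cball z r"
    then show "\<phi> holomorphic_on ball z r" by (rule holomorphic_on_subset) auto
    show "continuous_on (cball z r) \<phi>" using h by (rule holomorphic_on_imp_continuous_on)
    fix w assume "cmod (z - w) = r"
    then have w: "w \<in> cball z r" by (simp add: dist_norm)
    have "(cmod (p w - p z))\<^sup>2 \<le> (cmod (p w + cnj (p z)))\<^sup>2"
    proof -
      have "0 \<le> Re (p w) * Re (p z)" using p_pos[OF w] p_pos[OF zz] by simp
      then show ?thesis unfolding cmod_power2 by (simp add: power2_eq_square algebra_simps)
    qed
    then have "cmod (p w - p z) \<le> cmod (p w + cnj (p z))" by (rule power2_le_imp_le) simp
    then show "cmod (\<phi> w) \<le> 1" using nz[OF w] by (simp add: \<phi>_def norm_divide)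
  qed
  moreover have "deriv \<phi> z = deriv f z / of_real (2 * Re (p z))"
  proof (rule DERIV_imp_deriv)
    have "(f has_field_derivative deriv f z) (at z)"
      using holomorphic_derivI[OF holo \<open>open A\<close>] sub zz by blast
    then have "(p has_field_derivative deriv f z) (at z)"
      unfolding p_def by (auto intro!: derivative_eq_intros)
    then have "(\<phi> has_field_derivative
        (deriv f z * (p z + cnj (p z)) - (p z - p z) * deriv f z) / ((p z + cnj (p z)) * (p z + cnj (p z)))) (at z)"
      unfolding \<phi>_def using nz[OF zz] by (auto intro!: derivative_eq_intros)
    moreover have "p z + cnj (p z) = of_real (2 * Re (p z))" by (rule complex_add_cnj)
    ultimately show "(\<phi> has_field_derivative deriv f z / of_real (2 * Re (p z))) (at z)"
      using nz[OF zz] by (simp add: field_simps)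
  qed
  ultimately have "cmod (deriv f z) / (2 * Re (p z)) \<le> 1 / r"
    using p_pos[OF zz] by (simp add: norm_divide norm_mult)
  then have "cmod (deriv f z) \<le> 2 * Re (p z) / r"
    using p_pos[OF zz] by (simp add: pos_divide_le_eq)
  also have "\<dots> = 2 * Re (f z) / r + e" using r by (simp add: p_def \<epsilon>_def field_simps)
  finally show "cmod (deriv f z) \<le> 2 * Re (f z) / r + e" .
qed

lemma lower_half_plane_gradient_bound:
  fixes f :: "complex \<Rightarrow> complex"
  assumes "f holomorphic_on lower_half_plane" "\<And>z. Im z < 0 \<Longrightarrow> 0 \<le> Re (f z)" and z: "Im z < 0"
  shows "cmod (of_real (Im z) * deriv f z) \<le> 4 * Re (f z)"
proof -
  have "cmod (deriv f z) \<le> 2 * Re (f z) / (- Im z / 2)"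
    using cball_in_lower_half_plane(1)[OF z] assms
    by (intro nonneg_Re_gradient_bound[where A = lower_half_plane] open_halfspace_Im_lt) auto
  then show ?thesis using z by (simp add: norm_mult field_simps)
qed

lemma nonneg_Re_vanishing_imp_deriv_decay:
  fixes f :: "complex \<Rightarrow> complex"
  assumes "f holomorphic_on lower_half_plane" "\<And>z. Im z < 0 \<Longrightarrow> 0 \<le> Re (f z)"
    and "((\<lambda>z. Re (f z)) \<longlongrightarrow> 0) lower_infinity"
  shows "((\<lambda>z. of_real (Im z) * deriv f z) \<longlongrightarrow> 0) lower_infinity"
proof (rule Lim_null_comparison)
  show "\<forall>\<^sub>F z in lower_infinity. cmod (of_real (Im z) * deriv f z) \<le> 4 * Re (f z)"
    using eventually_lower_half_plane
    by eventually_elim (rule lower_half_plane_gradient_bound[OF assms(1,2)])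
  show "((\<lambda>z. 4 * Re (f z)) \<longlongrightarrow> 0) lower_infinity"
    using tendsto_mult_right_zero[OF assms(3)] .
qed

text \<open>
  The maximum principle gives \<open>Re f = 0\<close>, and then the gradient bound by \<open>Re f\<close> kills the derivative.
\<close>

lemma half_plane_zero_boundary_deriv:
  fixes f :: "complex \<Rightarrow> complex"
  assumes f: "continuous_on closed_lower_half_plane f" "f holomorphic_on lower_half_plane"
      "sublinear f"
    and zero: "\<And>t. Re (f (of_real t)) = 0" and z: "Im z < 0"
  shows "deriv f z = 0"
proof -
  have "0 \<le> Re (f z)" "Re (f z) \<le> 0" if "Im z < 0" for z
    using half_plane_nonneg[OF f _ that] half_plane_max_principle[OF f _ that] zero by auto
  then have "cmod (of_real (Im z) * deriv f z) \<le> 0"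
    using lower_half_plane_gradient_bound[OF f(2) _ z] z by fastforce
  then show ?thesis using z by simp
qed

lemma filterlim_vertical: "filterlim (\<lambda>y. Complex b (- y)) lower_infinity at_top"
proof -
  have "filterlim (\<lambda>y. cmod (Complex b (- y))) at_top at_top"
  proof (rule filterlim_at_top_mono[OF filterlim_ident])
    show "\<forall>\<^sub>F y in at_top. y \<le> cmod (Complex b (- y))"
      using abs_Im_le_cmod[of "Complex b _"] by (intro always_eventually allI) (metis abs_ge_self abs_minus_cancel complex.sel(2) order_trans)
  qed
  then have "filterlim (\<lambda>y. Complex b (- y)) at_infinity at_top"
    by (rule filterlim_norm_at_top_imp_at_infinity)
  moreover have "\<forall>\<^sub>F y in at_top. Complex b (- y) \<in> lower_half_plane"
    using eventually_gt_at_top[of 0] by eventually_elim simp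
  ultimately show ?thesis by (simp add: filterlim_inf filterlim_principal)
qed

text \<open>
  The decay of the derivative makes \<open>Re f\<close> of size \<open>o(1 / y)\<close> along every vertical line, because \<open>Re f\<close>
  tends to 0 there. This is less than a nonnegative harmonic function with nonzero boundary values
  can be.
\<close>

lemma half_plane_rigidity:
  fixes f :: "complex \<Rightarrow> complex"
  assumes f: "continuous_on closed_lower_half_plane f" "f holomorphic_on lower_half_plane"
      "sublinear f"
    and nonneg: "\<And>t. 0 \<le> Re (f (of_real t))"
    and lim: "((\<lambda>t. Re (f (of_real t))) \<longlongrightarrow> 0) at_infinity"
    and decay: "((\<lambda>z. of_real ((Im z)\<^sup>2) * deriv f z) \<longlongrightarrow> 0) lower_infinity"
  shows "Re (f (of_real b)) = 0"
proof (rule ccontr)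
  assume "Re (f (of_real b)) \<noteq> 0"
  then have "0 < Re (f (of_real b))" using nonneg[of b] by simp
  then obtain c where c: "0 < c" and lower: "\<forall>\<^sub>F y in at_top. c / y \<le> Re (f (Complex b (- y)))"
    using half_plane_lower_bound[OF f nonneg] by metis
  \<comment> \<open>\<open>\<phi>\<close> is eventually nondecreasing with limit 0, hence eventually nonpositive.\<close>
  define \<phi> where "\<phi> = (\<lambda>y. Re (f (Complex b (- y))) - c / 2 / y)"
  have "((\<lambda>y. Re (f (Complex b (- y)))) \<longlongrightarrow> 0) at_top"
    by (rule filterlim_compose[OF half_plane_vanishing_Re[OF f lim] filterlim_vertical])
  moreover have "((\<lambda>y::real. c / 2 / y) \<longlongrightarrow> 0) at_top"
    by (rule tendsto_divide_0[OF tendsto_const filterlim_at_top_imp_at_infinity[OF filterlim_ident]])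
  ultimately have \<phi>0: "(\<phi> \<longlongrightarrow> 0) at_top" unfolding \<phi>_def using tendsto_diff by fastforce
  have "((\<lambda>y. of_real ((Im (Complex b (- y)))\<^sup>2) * deriv f (Complex b (- y))) \<longlongrightarrow> 0) at_top"
    by (rule filterlim_compose[OF decay filterlim_vertical])
  from tendstoD[OF this half_gt_zero[OF c]] have "\<forall>\<^sub>F y in at_top.
      dist (of_real ((Im (Complex b (- y)))\<^sup>2) * deriv f (Complex b (- y))) 0 < c / 2" .
  then have "\<forall>\<^sub>F y in at_top. y\<^sup>2 * cmod (deriv f (Complex b (- y))) < c / 2"
    by eventually_elim (simp add: norm_mult norm_power)
  then have "\<forall>\<^sub>F y in at_top. y\<^sup>2 * cmod (deriv f (Complex b (- y))) < c / 2 \<and> 0 < y \<and> c / y \<le> Re (f (Complex b (- y)))"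
    using lower eventually_gt_at_top[of 0] by eventually_elim simp
  then obtain Y where Y: "\<And>y. Y \<le> y \<Longrightarrow> y\<^sup>2 * cmod (deriv f (Complex b (- y))) < c / 2"
      "\<And>y. Y \<le> y \<Longrightarrow> 0 < y" "\<And>y. Y \<le> y \<Longrightarrow> c / y \<le> Re (f (Complex b (- y)))"
    by (auto simp: eventually_at_top_linorder)
  have mono: "\<phi> x \<le> \<phi> y" if "Y \<le> x" "x \<le> y" for x y
  proof (rule DERIV_nonneg_imp_nondecreasing[OF \<open>x \<le> y\<close>])
    fix t assume t: "x \<le> t" "t \<le> y"
    then have Yt: "Y \<le> t" and t0: "0 < t" using that Y(2) by auto
    have "(f has_field_derivative deriv f (Complex b (- t))) (at (Complex b (- t)))"
      using holomorphic_derivI[OF f(2) open_halfspace_Im_lt] t0 by simp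
    moreover have "((\<lambda>t. Complex b (- t)) has_vector_derivative (- \<i>)) (at t)"
    proof -
      have "((\<lambda>t. of_real b - of_real t * \<i>) has_vector_derivative (- \<i>)) (at t)"
        by (auto intro!: derivative_eq_intros has_vector_derivative_real_field)
      moreover have "(\<lambda>t. of_real b - of_real t * \<i>) = (\<lambda>t. Complex b (- t))"
        by (auto simp: fun_eq_iff complex_eq_iff)
      ultimately show ?thesis by simp
    qed
    ultimately have "((f \<circ> (\<lambda>t. Complex b (- t))) has_vector_derivative (- \<i>) * deriv f (Complex b (- t))) (at t)"
      by (intro field_vector_diff_chain_at)
    then have "((\<lambda>t. Re (f (Complex b (- t)))) has_vector_derivative Re ((- \<i>) * deriv f (Complex b (- t)))) (at t)"
      using bounded_linear.has_vector_derivative[OF bounded_linear_Re] by (fastforce simp: o_def)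
    then have "((\<lambda>t. Re (f (Complex b (- t)))) has_real_derivative Im (deriv f (Complex b (- t)))) (at t)"
      by (simp add: has_real_derivative_iff_has_vector_derivative)
    moreover have "((\<lambda>t. c / 2 / t) has_real_derivative - (c / 2 / t\<^sup>2)) (at t)"
      using t0 by (auto intro!: derivative_eq_intros simp: power2_eq_square)
    ultimately have "(\<phi> has_real_derivative Im (deriv f (Complex b (- t))) - - (c / 2 / t\<^sup>2)) (at t)"
      unfolding \<phi>_def by (rule DERIV_diff)
    moreover have "cmod (deriv f (Complex b (- t))) \<le> c / 2 / t\<^sup>2"
      using Y(1)[OF Yt] t0 by (simp add: pos_le_divide_eq algebra_simps)
    then have "0 \<le> Im (deriv f (Complex b (- t))) - - (c / 2 / t\<^sup>2)"
      using abs_Im_le_cmod[of "deriv f (Complex b (- t))"] by linarith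
    ultimately show "\<exists>d. (\<phi> has_real_derivative d) (at t) \<and> 0 \<le> d" by blast
  qed
  have "\<phi> Y \<le> 0"
    by (rule tendsto_lowerbound[OF \<phi>0]) (use mono in \<open>auto simp: eventually_at_top_linorder\<close>)
  then have "c / Y \<le> c / 2 / Y" using Y(3)[of Y] by (simp add: \<phi>_def)
  then show False using c Y(2)[of Y] by (simp add: field_simps)
qed

section \<open>Besov functions vanish at infinity\<close>

lemma cis_lipschitz: "cmod (cis a - cis b) \<le> \<bar>a - b\<bar>"
proof -
  have "cis a - cis b = cis b * (cis (a - b) - 1)"
    by (simp add: right_diff_distrib cis_mult)
  then have "cmod (cis a - cis b) = 2 * \<bar>sin ((a - b) / 2)\<bar>"
    using dist_exp_i_1[of "a - b", folded cis_conv_exp] by (simp add: norm_mult)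
  also have "\<dots> \<le> 2 * \<bar>(a - b) / 2\<bar>"
    by (intro mult_left_mono abs_sin_x_le_abs_x) simp
  finally show ?thesis by simp
qed

text \<open>
  The decay comes from two integrations by parts, done at once: the derivative of \<open>(\<phi>' - \<i> x \<phi>) cis (x \<xi>)\<close> is
  \<open>(\<phi>'' + x\<^sup>2 \<phi>) cis (x \<xi>)\<close>, whose integral therefore vanishes.
\<close>

lemma oscillatory_integral_bounds:
  fixes \<phi> \<phi>' \<phi>'' :: "real \<Rightarrow> real"
  assumes d1: "\<And>\<xi>. (\<phi> has_real_derivative \<phi>' \<xi>) (at \<xi>)"
    and d2: "\<And>\<xi>. (\<phi>' has_real_derivative \<phi>'' \<xi>) (at \<xi>)"
    and cont: "continuous_on UNIV \<phi>''"
    and supp: "\<And>\<xi>. \<phi> \<xi> \<noteq> 0 \<Longrightarrow> \<bar>\<xi>\<bar> \<le> M"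
  obtains C L where
    "\<And>x. cmod (\<integral>\<xi>. of_real (\<phi> \<xi>) * cis (x * \<xi>) \<partial>lborel) * (1 + x\<^sup>2) \<le> C"
    "\<And>x y. cmod ((\<integral>\<xi>. of_real (\<phi> \<xi>) * cis (x * \<xi>) \<partial>lborel) - (\<integral>\<xi>. of_real (\<phi> \<xi>) * cis (y * \<xi>) \<partial>lborel))
       \<le> L * \<bar>x - y\<bar>"
proof -
  \<comment> \<open>One more than the support needs, so that \<open>\<phi>'\<close> also vanishes at the end points.\<close>
  define b where "b = \<bar>M\<bar> + 1"
  have b: "0 < b" "\<bar>M\<bar> < b" by (auto simp: b_def)
  have \<phi>0: "\<phi> \<xi> = 0" if "\<bar>M\<bar> < \<bar>\<xi>\<bar>" for \<xi> using supp[of \<xi>] that by linarith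
  have \<phi>'0: "\<phi>' \<xi> = 0" if "\<bar>\<xi>\<bar> = b" for \<xi>
  proof (rule DERIV_local_const[OF d1])
    show "0 < (1::real)" by simp
    show "\<forall>y. \<bar>\<xi> - y\<bar> < 1 \<longrightarrow> \<phi> \<xi> = \<phi> y"
    proof (intro allI impI)
      fix y assume "\<bar>\<xi> - y\<bar> < 1"
      then have "\<bar>M\<bar> < \<bar>y\<bar>" using that unfolding b_def by linarith
      then show "\<phi> \<xi> = \<phi> y" using \<phi>0[of y] \<phi>0[of \<xi>] that b(2) by simp
    qed
  qed
  have c\<phi>: "continuous_on A \<phi>" for A
    using d1 by (meson DERIV_isCont continuous_at_imp_continuous_on)
  have c\<phi>'': "continuous_on A \<phi>''" for A using cont continuous_on_subset by blast
  define T where "T = (\<lambda>g x. integral {-b..b} (\<lambda>\<xi>. of_real (g \<xi>) * cis (x * \<xi>)))"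
  have ii: "(\<lambda>\<xi>. of_real (g \<xi>) * cis (x * \<xi>)) integrable_on {-b..b}" if "continuous_on {-b..b} g" for g x
    by (intro integrable_continuous_real continuous_intros that)
  have I_eq: "(\<integral>\<xi>. of_real (\<phi> \<xi>) * cis (x * \<xi>) \<partial>lborel) = T \<phi> x" for x
  proof -
    have "set_integrable lborel {-b..b} (\<lambda>\<xi>. of_real (\<phi> \<xi>) * cis (x * \<xi>))"
      unfolding set_integrable_def
      by (intro borel_integrable_compact continuous_intros c\<phi>) simp
    then have "(LINT \<xi>:{-b..b}|lborel. of_real (\<phi> \<xi>) * cis (x * \<xi>)) = T \<phi> x"
      unfolding T_def by (rule set_borel_integral_eq_integral(2))
    moreover have "indicator {-b..b} \<xi> *\<^sub>R (of_real (\<phi> \<xi>) * cis (x * \<xi>)) = of_real (\<phi> \<xi>) * cis (x * \<xi>)" for \<xi>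
    proof (cases "\<xi> \<in> {-b..b}")
      case False
      then have "\<bar>M\<bar> < \<bar>\<xi>\<bar>" using b unfolding atLeastAtMost_iff by linarith
      then show ?thesis using \<phi>0[of \<xi>] by simp
    qed simp
    ultimately show ?thesis by (simp add: set_lebesgue_integral_def)
  qed
  have T_bound: "cmod (T g x) \<le> integral {-b..b} (\<lambda>\<xi>. \<bar>g \<xi>\<bar>)" if "continuous_on {-b..b} g" for g x
    unfolding T_def
    by (rule integral_norm_bound_integral)
       (auto intro!: ii that integrable_continuous_real continuous_intros simp: norm_mult)
  have T_parts: "of_real (x\<^sup>2) * T \<phi> x = - T \<phi>'' x" for x
  proof -
    have "((\<lambda>\<xi>. of_real (\<phi>'' \<xi> + x\<^sup>2 * \<phi> \<xi>) * cis (x * \<xi>)) has_integral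
        (of_real (\<phi>' b) - \<i> * of_real x * of_real (\<phi> b)) * cis (x * b)
        - (of_real (\<phi>' (-b)) - \<i> * of_real x * of_real (\<phi> (-b))) * cis (x * (-b))) {-b..b}"
    proof (rule fundamental_theorem_of_calculus)
      show "- b \<le> b" using b by simp
      fix \<xi>
      have c: "((\<lambda>\<xi>. cis (x * \<xi>)) has_vector_derivative (of_real x * \<i> * cis (x * \<xi>))) (at \<xi> within {-b..b})"
        unfolding has_vector_derivative_def
        by (auto intro!: derivative_eq_intros simp: scaleR_conv_of_real fun_eq_iff)
      have f: "((\<lambda>\<xi>. of_real (\<phi>' \<xi>) - \<i> * of_real x * of_real (\<phi> \<xi>)) has_vector_derivative
          (of_real (\<phi>'' \<xi>) - \<i> * of_real x * of_real (\<phi>' \<xi>))) (at \<xi> within {-b..b})"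
        by (intro has_vector_derivative_diff has_vector_derivative_mult_right has_vector_derivative_of_real
            has_field_derivative_at_within[OF d1] has_field_derivative_at_within[OF d2])
      have "((\<lambda>\<xi>. (of_real (\<phi>' \<xi>) - \<i> * of_real x * of_real (\<phi> \<xi>)) * cis (x * \<xi>)) has_vector_derivative
          ((of_real (\<phi>' \<xi>) - \<i> * of_real x * of_real (\<phi> \<xi>)) * (of_real x * \<i> * cis (x * \<xi>))
           + (of_real (\<phi>'' \<xi>) - \<i> * of_real x * of_real (\<phi>' \<xi>)) * cis (x * \<xi>))) (at \<xi> within {-b..b})"
        by (rule has_vector_derivative_mult[OF f c])
      moreover have "(of_real (\<phi>' \<xi>) - \<i> * of_real x * of_real (\<phi> \<xi>)) * (of_real x * \<i> * cis (x * \<xi>))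
           + (of_real (\<phi>'' \<xi>) - \<i> * of_real x * of_real (\<phi>' \<xi>)) * cis (x * \<xi>)
          = of_real (\<phi>'' \<xi> + x\<^sup>2 * \<phi> \<xi>) * cis (x * \<xi>)"
        by (simp add: algebra_simps power2_eq_square)
      ultimately show "((\<lambda>\<xi>. (of_real (\<phi>' \<xi>) - \<i> * of_real x * of_real (\<phi> \<xi>)) * cis (x * \<xi>)) has_vector_derivative
          of_real (\<phi>'' \<xi> + x\<^sup>2 * \<phi> \<xi>) * cis (x * \<xi>)) (at \<xi> within {-b..b})" by simp
    qed
    then have "integral {-b..b} (\<lambda>\<xi>. of_real (\<phi>'' \<xi> + x\<^sup>2 * \<phi> \<xi>) * cis (x * \<xi>)) = 0"
      using \<phi>0[of b] \<phi>0[of "-b"] \<phi>'0[of b] \<phi>'0[of "-b"] b by (simp add: integral_unique)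
    moreover have "integral {-b..b} (\<lambda>\<xi>. of_real (\<phi>'' \<xi> + x\<^sup>2 * \<phi> \<xi>) * cis (x * \<xi>)) =
        integral {-b..b} (\<lambda>\<xi>. of_real (\<phi>'' \<xi>) * cis (x * \<xi>) + of_real (x\<^sup>2) * (of_real (\<phi> \<xi>) * cis (x * \<xi>)))"
      by (simp add: algebra_simps)
    moreover have "\<dots> = T \<phi>'' x + of_real (x\<^sup>2) * T \<phi> x"
      unfolding T_def by (subst integral_add) (auto intro!: ii c\<phi> c\<phi>'' integrable_on_mult_right)
    ultimately show ?thesis by (simp add: eq_neg_iff_add_eq_0 add.commute)
  qed
  show thesis
  proof
    fix x y :: real
    have "cmod (T \<phi> x) * (1 + x\<^sup>2) = cmod (T \<phi> x) + cmod (of_real (x\<^sup>2) * T \<phi> x)"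
      by (simp add: norm_mult algebra_simps norm_power)
    also have "\<dots> = cmod (T \<phi> x) + cmod (T \<phi>'' x)" by (simp add: T_parts del: of_real_power)
    also have "\<dots> \<le> integral {-b..b} (\<lambda>\<xi>. \<bar>\<phi> \<xi>\<bar>) + integral {-b..b} (\<lambda>\<xi>. \<bar>\<phi>'' \<xi>\<bar>)"
      by (intro add_mono T_bound c\<phi> c\<phi>'')
    finally show "cmod (\<integral>\<xi>. of_real (\<phi> \<xi>) * cis (x * \<xi>) \<partial>lborel) * (1 + x\<^sup>2)
        \<le> integral {-b..b} (\<lambda>\<xi>. \<bar>\<phi> \<xi>\<bar>) + integral {-b..b} (\<lambda>\<xi>. \<bar>\<phi>'' \<xi>\<bar>)" by (simp add: I_eq)
    have "T \<phi> x - T \<phi> y = integral {-b..b} (\<lambda>\<xi>. of_real (\<phi> \<xi>) * cis (x * \<xi>) - of_real (\<phi> \<xi>) * cis (y * \<xi>))"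
      unfolding T_def by (intro integral_diff[symmetric] ii c\<phi>)
    also have "cmod \<dots> \<le> integral {-b..b} (\<lambda>\<xi>. (\<bar>\<phi> \<xi>\<bar> * \<bar>\<xi>\<bar>) * \<bar>x - y\<bar>)"
    proof (rule integral_norm_bound_integral)
      fix \<xi>
      have "cmod (of_real (\<phi> \<xi>) * cis (x * \<xi>) - of_real (\<phi> \<xi>) * cis (y * \<xi>)) = \<bar>\<phi> \<xi>\<bar> * cmod (cis (x * \<xi>) - cis (y * \<xi>))"
        by (simp add: norm_mult flip: right_diff_distrib)
      also have "\<dots> \<le> \<bar>\<phi> \<xi>\<bar> * \<bar>x * \<xi> - y * \<xi>\<bar>" by (intro mult_left_mono cis_lipschitz) simp
      also have "\<dots> = (\<bar>\<phi> \<xi>\<bar> * \<bar>\<xi>\<bar>) * \<bar>x - y\<bar>" by (simp add: abs_mult flip: left_diff_distrib)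
      finally show "cmod (of_real (\<phi> \<xi>) * cis (x * \<xi>) - of_real (\<phi> \<xi>) * cis (y * \<xi>)) \<le> (\<bar>\<phi> \<xi>\<bar> * \<bar>\<xi>\<bar>) * \<bar>x - y\<bar>" .
    qed (auto intro!: integrable_diff ii c\<phi> integrable_continuous_real continuous_intros)
    also have "\<dots> = integral {-b..b} (\<lambda>\<xi>. \<bar>\<phi> \<xi>\<bar> * \<bar>\<xi>\<bar>) * \<bar>x - y\<bar>" by simp
    finally show "cmod ((\<integral>\<xi>. of_real (\<phi> \<xi>) * cis (x * \<xi>) \<partial>lborel) - (\<integral>\<xi>. of_real (\<phi> \<xi>) * cis (y * \<xi>) \<partial>lborel))
       \<le> integral {-b..b} (\<lambda>\<xi>. \<bar>\<phi> \<xi>\<bar> * \<bar>\<xi>\<bar>) * \<bar>x - y\<bar>" by (simp add: I_eq)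
  qed
qed

lemma integrable_inverse_one_plus_square: "integrable lborel (\<lambda>x::real. 1 / (1 + x\<^sup>2))"
  using integrable_inverse_1_plus_square
  by (simp add: set_integrable_def einterval_def inverse_eq_divide)

lemma integrable_quadratic_decay:
  fixes k :: "real \<Rightarrow> complex"
  assumes "k \<in> borel_measurable lborel" "\<And>x. cmod (k x) * (1 + x\<^sup>2) \<le> C"
  shows "integrable lborel k"
proof (rule Bochner_Integration.integrable_bound)
  show "integrable lborel (\<lambda>x::real. C * (1 / (1 + x\<^sup>2)))"
    by (intro integrable_mult_right integrable_inverse_one_plus_square)
  have "cmod (k x) \<le> C * (1 / (1 + x\<^sup>2))" for x
    using assms(2)[of x] by (simp add: pos_le_divide_eq add_pos_nonneg)
  then have "norm (k x) \<le> norm (C * (1 / (1 + x\<^sup>2)))" for x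
    unfolding real_norm_def using order_trans[OF _ abs_ge_self] by blast
  then show "AE x in lborel. norm (k x) \<le> norm (C * (1 / (1 + x\<^sup>2)))"
    by (rule AE_I2)
qed (fact assms(1))

text \<open>
  Dominated convergence: for shifts bounded by \<open>B\<close>, the shifted decay \<open>1 / (1 + (s + h)\<^sup>2)\<close> is at most a
  constant times \<open>1 / (1 + s\<^sup>2)\<close>, because \<open>s\<^sup>2 \<le> 2 (s + h)\<^sup>2 + 2 h\<^sup>2\<close>.
\<close>

lemma translation_continuous_L1:
  fixes k :: "real \<Rightarrow> complex"
  assumes cont: "continuous_on UNIV k" and decay: "\<And>x. cmod (k x) * (1 + x\<^sup>2) \<le> C"
  shows "((\<lambda>h. \<integral>s. cmod (k (s + h) - k s) \<partial>lborel) \<longlongrightarrow> 0) (at 0)"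
  unfolding tendsto_at_iff_sequentially
proof (intro allI impI)
  fix X :: "nat \<Rightarrow> real" assume "X \<longlonglongrightarrow> 0"
  then have "Bseq X" by (intro convergent_imp_Bseq convergentI)
  then obtain B where "\<forall>i. norm (X i) \<le> B" by (rule BseqE)
  then have B: "\<bar>X i\<bar> \<le> B" for i by simp
  have "cmod (k 0) \<le> C" using decay[of 0] by simp
  then have C: "0 \<le> C" by (rule order_trans[OF norm_ge_zero])
  have meas: "k \<in> borel_measurable borel" using cont by (rule borel_measurable_continuous_onI)
  define w where "w = (\<lambda>s::real. C * (3 + 2 * B\<^sup>2) * (1 / (1 + s\<^sup>2)))"
  have "(\<lambda>i. \<integral>s. cmod (k (s + X i) - k s) \<partial>lborel) \<longlonglongrightarrow> (\<integral>s. 0 \<partial>(lborel :: real measure))"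
  proof (rule integral_dominated_convergence[where w = w])
    show "integrable lborel w" unfolding w_def
      by (intro integrable_mult_right integrable_inverse_one_plus_square)
    show "(\<lambda>s. cmod (k (s + X i) - k s)) \<in> borel_measurable lborel" for i
      using meas by measurable
    show "AE s in lborel. (\<lambda>i. cmod (k (s + X i) - k s)) \<longlonglongrightarrow> 0"
    proof (rule AE_I2)
      fix s
      have "(\<lambda>i. s + X i) \<longlonglongrightarrow> s + 0" by (intro tendsto_intros \<open>X \<longlonglongrightarrow> 0\<close>)
      moreover have "isCont k s" using cont by (simp add: continuous_on_eq_continuous_at)
      ultimately have "(\<lambda>i. k (s + X i)) \<longlonglongrightarrow> k s" using isCont_tendsto_compose by fastforce
      then show "(\<lambda>i. cmod (k (s + X i) - k s)) \<longlonglongrightarrow> 0"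
        using tendsto_norm_zero LIM_zero by blast
    qed
    show "AE s in lborel. norm (cmod (k (s + X i) - k s)) \<le> w s" for i
    proof (rule AE_I2)
      fix s
      have kb: "cmod (k x) \<le> C / (1 + x\<^sup>2)" for x
        using decay[of x] by (simp add: pos_le_divide_eq add_pos_nonneg)
      have "s\<^sup>2 \<le> 2 * (s + X i)\<^sup>2 + 2 * (X i)\<^sup>2"
        using zero_le_power2[of "s + 2 * X i"] by (simp add: power2_eq_square algebra_simps)
      moreover have "(X i)\<^sup>2 \<le> B\<^sup>2" using B[of i] by (metis abs_ge_zero power2_abs power_mono)
      moreover have "0 \<le> 2 * B\<^sup>2 * (s + X i)\<^sup>2" by simp
      ultimately have "1 + s\<^sup>2 \<le> (2 + 2 * B\<^sup>2) * (1 + (s + X i)\<^sup>2)"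
        unfolding distrib_left distrib_right using zero_le_power2[of "s + X i"] by linarith
      then have "1 / (1 + (s + X i)\<^sup>2) \<le> (2 + 2 * B\<^sup>2) / (1 + s\<^sup>2)"
        by (simp add: pos_le_divide_eq pos_divide_le_eq add_pos_nonneg)
      then have "C * (1 / (1 + (s + X i)\<^sup>2)) \<le> C * ((2 + 2 * B\<^sup>2) / (1 + s\<^sup>2))"
        using C by (intro mult_left_mono)
      then have "cmod (k (s + X i)) + cmod (k s) \<le> C * ((2 + 2 * B\<^sup>2) / (1 + s\<^sup>2)) + C / (1 + s\<^sup>2)"
        using kb[of "s + X i"] kb[of s] by simp
      also have "\<dots> = w s" by (simp add: w_def algebra_simps flip: add_divide_distrib)
      finally show "norm (cmod (k (s + X i) - k s)) \<le> w s"
        using norm_triangle_ineq4[of "k (s + X i)" "k s"] by simp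
    qed
  qed auto
  then show "((\<lambda>h. \<integral>s. cmod (k (s + h) - k s) \<partial>lborel) \<circ> X) \<longlonglongrightarrow> 0" by (simp add: o_def)
qed

text \<open>
  The increment of the convolution is bounded by the sup norm of \<open>u\<close> times the \<open>L\<^sup>1\<close> distance between \<open>k\<close>
  and its translate, which depends on the translation only and not on the point.
\<close>

lemma convolution_uniformly_continuous:
  fixes k u :: "real \<Rightarrow> complex"
  assumes k: "continuous_on UNIV k" "\<And>x. cmod (k x) * (1 + x\<^sup>2) \<le> C"
    and u: "continuous_on UNIV u" "bounded (range u)"
  shows "uniformly_continuous_on UNIV (\<lambda>x. \<integral>y. k (x - y) * u y \<partial>lborel)"
  unfolding uniformly_continuous_on_def
proof (intro allI impI)
  fix e :: real assume "0 < e"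
  obtain M where M: "0 < M" "\<And>y. cmod (u y) \<le> M" using u(2) by (auto simp: bounded_pos)
  define J where "J = (\<lambda>h. \<integral>s. cmod (k (s + h) - k s) \<partial>lborel)"
  have "(J \<longlongrightarrow> 0) (at 0)" unfolding J_def by (rule translation_continuous_L1[OF k])
  then have "\<forall>\<^sub>F h in at 0. dist (J h) 0 < e / M"
    by (rule tendstoD) (use \<open>0 < e\<close> M in simp)
  then obtain d where d: "0 < d" "\<And>h. h \<noteq> 0 \<Longrightarrow> \<bar>h\<bar> < d \<Longrightarrow> \<bar>J h\<bar> < e / M"
    by (auto simp: eventually_at dist_real_def)
  have meas: "k \<in> borel_measurable borel" "u \<in> borel_measurable borel"
    using k u by (auto intro: borel_measurable_continuous_onI)
  have ik: "integrable lborel k" using meas by (intro integrable_quadratic_decay[OF _ k(2)]) simp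
  have ik_refl: "integrable lborel (\<lambda>y. k (x - y))" for x
    using lborel_integrable_real_affine[OF ik, of "-1" x] by simp
  have iku: "integrable lborel (\<lambda>y. k (x - y) * u y)" for x
  proof (rule Bochner_Integration.integrable_bound)
    show "integrable lborel (\<lambda>y. M * cmod (k (x - y)))"
      by (intro integrable_mult_right integrable_norm ik_refl)
    show "(\<lambda>y. k (x - y) * u y) \<in> borel_measurable lborel" using meas by measurable
    have "cmod (k (x - y)) * cmod (u y) \<le> M * cmod (k (x - y))" for y
      using M(2)[of y] by (subst mult.commute) (intro mult_right_mono, auto)
    then show "AE y in lborel. norm (k (x - y) * u y) \<le> norm (M * cmod (k (x - y)))"
      using M(1) by (simp add: norm_mult)
  qed
  have main: "cmod ((\<integral>y. k (x' - y) * u y \<partial>lborel) - (\<integral>y. k (x - y) * u y \<partial>lborel)) \<le> M * J (x' - x)" for x x'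
  proof -
    have i: "integrable lborel (\<lambda>y. cmod (k (x' - y) - k (x - y)))"
      by (intro integrable_norm Bochner_Integration.integrable_diff ik_refl)
    have "(\<integral>y. k (x' - y) * u y \<partial>lborel) - (\<integral>y. k (x - y) * u y \<partial>lborel)
        = (\<integral>y. k (x' - y) * u y - k (x - y) * u y \<partial>lborel)"
      by (rule Bochner_Integration.integral_diff[symmetric]) (rule iku)+
    also have "cmod \<dots> \<le> (\<integral>y. M * cmod (k (x' - y) - k (x - y)) \<partial>lborel)"
    proof (rule Bochner_Integration.integral_norm_bound_integral)
      show "integrable lborel (\<lambda>y. k (x' - y) * u y - k (x - y) * u y)"
        by (intro Bochner_Integration.integrable_diff iku)
      show "integrable lborel (\<lambda>y. M * cmod (k (x' - y) - k (x - y)))"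
        by (intro integrable_mult_right i)
      fix y
      have "cmod (k (x' - y) * u y - k (x - y) * u y) = cmod (u y) * cmod (k (x' - y) - k (x - y))"
        by (metis left_diff_distrib norm_mult mult.commute)
      also have "\<dots> \<le> M * cmod (k (x' - y) - k (x - y))" by (intro mult_right_mono M) simp
      finally show "cmod (k (x' - y) * u y - k (x - y) * u y) \<le> M * cmod (k (x' - y) - k (x - y))" .
    qed
    also have "\<dots> = M * (\<integral>y. cmod (k (x' - y) - k (x - y)) \<partial>lborel)" by simp
    also have "(\<integral>y. cmod (k (x' - y) - k (x - y)) \<partial>lborel) = J (x' - x)"
      unfolding J_def by (subst lborel_integral_real_affine[of "-1" _ x]) (simp_all add: algebra_simps)
    finally show ?thesis .
  qed
  show "\<exists>d>0. \<forall>x\<in>UNIV. \<forall>x'\<in>UNIV. dist x' x < d \<longrightarrow>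
      dist (\<integral>y. k (x' - y) * u y \<partial>lborel) (\<integral>y. k (x - y) * u y \<partial>lborel) < e"
  proof (intro exI conjI ballI impI)
    show "0 < d" by fact
    fix x x' :: real assume xx: "dist x' x < d"
    show "dist (\<integral>y. k (x' - y) * u y \<partial>lborel) (\<integral>y. k (x - y) * u y \<partial>lborel) < e"
    proof (cases "x' = x")
      case False
      then have "\<bar>J (x' - x)\<bar> < e / M" using d(2)[of "x' - x"] xx by (simp add: dist_real_def)
      then have "J (x' - x) < e / M" by linarith
      then have "M * J (x' - x) < e" using M(1) by (simp add: pos_less_divide_eq mult.commute)
      then show ?thesis using main[of x' x] by (simp add: dist_norm)
    qed (use \<open>0 < e\<close> in simp)
  qed
qed

text \<open>
  If \<open>\<bar>f x\<bar> \<ge> e\<close>, then \<open>\<bar>f\<bar> \<ge> e/2\<close> on an interval around \<open>x\<close> whose length \<open>2 d\<close> does not depend on \<open>x\<close>.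
  Far out, the tail of the \<open>L\<^sup>2\<close> integral is too small for this.
\<close>

lemma uniformly_continuous_L2_vanishing:
  fixes f :: "real \<Rightarrow> complex"
  assumes uc: "uniformly_continuous_on UNIV f" and int: "integrable lborel (\<lambda>x. (cmod (f x))\<^sup>2)"
  shows "(f \<longlongrightarrow> 0) at_infinity"
proof (rule tendstoI)
  fix e :: real assume e: "0 < e"
  obtain d where d: "0 < d" "\<And>x y. \<bar>x - y\<bar> < d \<Longrightarrow> cmod (f x - f y) < e / 2"
    using uc e unfolding uniformly_continuous_on_def dist_norm real_norm_def
    by (metis UNIV_I half_gt_zero)
  define T where "T = (\<lambda>A. \<integral>t. indicator {t. A \<le> \<bar>t\<bar>} t * (cmod (f t))\<^sup>2 \<partial>lborel)"
  have meas: "(\<lambda>x. (cmod (f x))\<^sup>2) \<in> borel_measurable borel"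
    using borel_measurable_integrable[OF int] by simp
  have iT: "integrable lborel (\<lambda>t. indicator {t. A \<le> \<bar>t\<bar>} t * (cmod (f t))\<^sup>2)" for A
    by (rule integrable_real_mult_indicator[OF _ int, unfolded mult.commute[of _ "indicator _ _"]]) simp
  have "(\<lambda>n. T (real n)) \<longlonglongrightarrow> (\<integral>t. 0 \<partial>(lborel :: real measure))"
    unfolding T_def
  proof (rule integral_dominated_convergence[where w = "\<lambda>x. (cmod (f x))\<^sup>2"])
    show "(\<lambda>t. indicator {t. real n \<le> \<bar>t\<bar>} t * (cmod (f t))\<^sup>2) \<in> borel_measurable lborel" for n
      using borel_measurable_integrable[OF iT] .
    show "AE t in lborel. (\<lambda>n. indicator {t. real n \<le> \<bar>t\<bar>} t * (cmod (f t))\<^sup>2) \<longlonglongrightarrow> 0"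
    proof (rule AE_I2)
      fix t :: real
      have "\<forall>\<^sub>F n in sequentially. \<bar>t\<bar> < real n"
        using filterlim_real_sequentially by (simp add: filterlim_at_top_dense)
      then have "\<forall>\<^sub>F n in sequentially. 0 = indicator {t. real n \<le> \<bar>t\<bar>} t * (cmod (f t))\<^sup>2"
        by eventually_elim simp
      then show "(\<lambda>n. indicator {t. real n \<le> \<bar>t\<bar>} t * (cmod (f t))\<^sup>2) \<longlonglongrightarrow> 0"
        by (rule Lim_transform_eventually[OF tendsto_const])
    qed
    show "AE t in lborel. norm (indicator {t. real n \<le> \<bar>t\<bar>} t * (cmod (f t))\<^sup>2) \<le> (cmod (f t))\<^sup>2" for n
      by (rule AE_I2) (auto simp: indicator_def)
  qed (use int in auto)
  then have "(\<lambda>n. T (real n)) \<longlonglongrightarrow> 0" by simp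
  then have "\<forall>\<^sub>F n in sequentially. T (real n) < 2 * d * (e / 2)\<^sup>2"
    by (rule order_tendstoD(2)) (use d e in simp)
  then obtain A where A: "T A < 2 * d * (e / 2)\<^sup>2"
    by (auto simp: eventually_sequentially)
  have "dist (f x) 0 < e" if x: "A + d \<le> \<bar>x\<bar>" for x
  proof (rule ccontr)
    assume "\<not> dist (f x) 0 < e"
    then have fx: "e \<le> cmod (f x)" by simp
    have "(\<integral>t. indicator {x-d<..<x+d} t * (e / 2)\<^sup>2 \<partial>lborel) \<le> T A"
      unfolding T_def
    proof (rule integral_mono[OF _ iT])
      show "integrable lborel (\<lambda>t. indicator {x-d<..<x+d} t * (e / 2)\<^sup>2)"
        by (intro integrable_mult_left) (use d(1) in \<open>simp add: integrable_indicator_iff\<close>)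
      fix t
      show "indicator {x-d<..<x+d} t * (e / 2)\<^sup>2 \<le> indicator {t. A \<le> \<bar>t\<bar>} t * (cmod (f t))\<^sup>2"
      proof (cases "t \<in> {x-d<..<x+d}")
        case True
        then have "\<bar>x - t\<bar> < d" unfolding greaterThanLessThan_iff by linarith
        then have "cmod (f x - f t) < e / 2" by (rule d(2))
        then have "e / 2 \<le> cmod (f t)" using fx norm_triangle_ineq2[of "f x" "f t"] by linarith
        then have "(e / 2)\<^sup>2 \<le> (cmod (f t))\<^sup>2" using e by (intro power_mono) auto
        moreover have "A \<le> \<bar>t\<bar>" using \<open>\<bar>x - t\<bar> < d\<close> x by linarith
        ultimately show ?thesis using True by simp
      qed simp
    qed
    then have "2 * d * (e / 2)\<^sup>2 \<le> T A" using d(1) by simp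
    then show False using A by simp
  qed
  then show "\<forall>\<^sub>F x in at_infinity. dist (f x) 0 < e"
    by (auto simp: eventually_at_infinity)
qed

lemma littlewood_paley_kernel:
  assumes "littlewood_paley \<psi>"
  obtains C where "continuous_on UNIV (lp_kernel \<psi> k)" "\<And>x. cmod (lp_kernel \<psi> k x) * (1 + x\<^sup>2) \<le> C"
proof -
  define D where "D = (\<lambda>h::real \<Rightarrow> real. \<lambda>t. vector_derivative h (at t))"
  define c :: real where "c = 2 powi k"
  have c: "0 < c" by (simp add: c_def)
  have smooth: "((D ^^ n) \<psi>) differentiable (at x)" for n x
    using assms by (simp add: littlewood_paley_def smooth_on_def D_def)
  have step: "((D ^^ n) \<psi> has_real_derivative (D ^^ Suc n) \<psi> x) (at x)" for n x
    using smooth[of n x] vector_derivative_works[of "(D ^^ n) \<psi>" "at x"]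
    by (simp add: has_real_derivative_iff_has_vector_derivative D_def)
  have d: "((\<lambda>\<xi>. (D ^^ n) \<psi> (\<xi> / c) / c ^ n) has_real_derivative (D ^^ Suc n) \<psi> (\<xi> / c) / c ^ Suc n) (at \<xi>)" for n \<xi>
    using c by (auto intro!: derivative_eq_intros DERIV_chain2[OF step] simp: field_simps simp del: funpow.simps)
  have cont2: "continuous_on UNIV (\<lambda>\<xi>. (D ^^ 2) \<psi> (\<xi> / c) / c ^ 2)"
    using d[of 2] by (meson DERIV_isCont continuous_at_imp_continuous_on)
  have supp: "\<bar>\<xi>\<bar> \<le> 2 * c" if "(D ^^ 0) \<psi> (\<xi> / c) / c ^ 0 \<noteq> 0" for \<xi>
  proof -
    have "\<bar>\<xi> / c\<bar> \<le> 2" using assms that by (auto simp: littlewood_paley_def)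
    then show ?thesis using c by (simp add: abs_divide pos_divide_le_eq)
  qed
  define I where "I = (\<lambda>x. \<integral>\<xi>. of_real (\<psi> (\<xi> / c)) * cis (x * \<xi>) \<partial>lborel)"
  obtain C L where CL: "\<And>x. cmod (I x) * (1 + x\<^sup>2) \<le> C" "\<And>x y. cmod (I x - I y) \<le> L * \<bar>x - y\<bar>"
    using oscillatory_integral_bounds[OF d[of 0] d[of "Suc 0"] cont2[unfolded numeral_2_eq_2] supp]
    by (auto simp: I_def)
  have "continuous_on UNIV I"
  proof (rule continuous_at_imp_continuous_on, rule ballI)
    fix x
    have "((\<lambda>y. I y - I x) \<longlongrightarrow> 0) (at x)"
    proof (rule Lim_null_comparison)
      show "\<forall>\<^sub>F y in at x. norm (I y - I x) \<le> L * \<bar>y - x\<bar>" using CL(2) by simp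
      have "((\<lambda>y. L * \<bar>y - x\<bar>) \<longlongrightarrow> L * \<bar>x - x\<bar>) (at x)" by (intro tendsto_intros)
      then show "((\<lambda>y. L * \<bar>y - x\<bar>) \<longlongrightarrow> 0) (at x)" by simp
    qed
    then show "isCont I x" by (simp add: isCont_def LIM_zero_iff)
  qed
  moreover have k_eq: "lp_kernel \<psi> k = (\<lambda>x. 1 / (2 * of_real pi) * I x)"
    by (simp add: fun_eq_iff lp_kernel_def I_def c_def)
  ultimately have "continuous_on UNIV (lp_kernel \<psi> k)" by (auto intro!: continuous_intros)
  moreover have "cmod (lp_kernel \<psi> k x) * (1 + x\<^sup>2) \<le> C / (2 * pi)" for x
  proof -
    have "cmod (lp_kernel \<psi> k x) * (1 + x\<^sup>2) = cmod (I x) * (1 + x\<^sup>2) / (2 * pi)"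
      by (simp add: k_eq norm_divide norm_mult)
    also have "\<dots> \<le> C / (2 * pi)" using CL(1)[of x] by (intro divide_right_mono) auto
    finally show ?thesis .
  qed
  ultimately show thesis using that by blast
qed

text \<open>
  Every dyadic piece is in \<open>L\<^sup>2\<close>, and it is uniformly continuous because it is the convolution of a
  bounded function with an integrable kernel; hence it vanishes at infinity. Uniform convergence passes
  this on to the sum.
\<close>

lemma besov_half_vanishing_at_infinity:
  assumes lp: "littlewood_paley \<psi>" and u: "u \<in> besov_half \<psi>"
  shows "(u \<longlongrightarrow> 0) at_infinity"
proof (rule tendstoI)
  fix e :: real assume e: "0 < e"
  have piece: "(lp_proj \<psi> k u \<longlongrightarrow> 0) at_infinity" for k
  proof (rule uniformly_continuous_L2_vanishing)
    obtain C where C: "continuous_on UNIV (lp_kernel \<psi> k)" "\<And>x. cmod (lp_kernel \<psi> k x) * (1 + x\<^sup>2) \<le> C"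
      using littlewood_paley_kernel[OF lp] by blast
    have "lp_proj \<psi> k u = (\<lambda>x. \<integral>y. lp_kernel \<psi> k (x - y) * u y \<partial>lborel)"
      by (simp add: fun_eq_iff lp_proj_def)
    then show "uniformly_continuous_on UNIV (lp_proj \<psi> k u)"
      using convolution_uniformly_continuous[OF C] u by (simp add: besov_half_def)
    show "integrable lborel (\<lambda>x. (cmod (lp_proj \<psi> k u x))\<^sup>2)"
      using u by (simp add: besov_half_def in_L2_def)
  qed
  have "uniform_limit UNIV (\<lambda>K x. \<Sum>k\<in>K. lp_proj \<psi> k u x) u (finite_subsets_at_top UNIV)"
    using u by (simp add: besov_half_def)
  then have "\<forall>\<^sub>F K in finite_subsets_at_top UNIV. \<forall>x\<in>UNIV. dist (\<Sum>k\<in>K. lp_proj \<psi> k u x) (u x) < e / 2"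
    using e by (intro uniform_limitD) auto
  then obtain K where K: "\<And>x. dist (\<Sum>k\<in>K. lp_proj \<psi> k u x) (u x) < e / 2"
    using eventually_happens'[OF finite_subsets_at_top_neq_bot] by fastforce
  have "((\<lambda>x. \<Sum>k\<in>K. lp_proj \<psi> k u x) \<longlongrightarrow> (\<Sum>k\<in>K. 0)) at_infinity"
    by (intro tendsto_sum piece)
  then have "\<forall>\<^sub>F x in at_infinity. dist (\<Sum>k\<in>K. lp_proj \<psi> k u x) 0 < e / 2"
    by (intro tendstoD) (use e in auto)
  then show "\<forall>\<^sub>F x in at_infinity. dist (u x) 0 < e"
  proof eventually_elim
    case (elim x)
    then show ?case using K[of x] dist_triangle[of "u x" 0 "\<Sum>k\<in>K. lp_proj \<psi> k u x"]
      by (simp add: dist_commute)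
  qed
qed

section \<open>Boundary values at crests\<close>

lemma lower_powr_tendsto_zero:
  assumes "0 < p"
  shows "((\<lambda>z. lower_powr (z - a) p) \<longlongrightarrow> 0) (at a within A)"
proof (rule Lim_null_comparison)
  have "\<forall>\<^sub>F z in at a within A. z \<noteq> a" by (simp add: eventually_at_filter)
  then show "\<forall>\<^sub>F z in at a within A. norm (lower_powr (z - a) p) \<le> cmod (z - a) powr p"
  proof eventually_elim
    case (elim z)
    then have "cmod (\<i> * (z - a)) = cmod (z - a)" "\<i> * (z - a) \<noteq> 0" by (simp_all add: norm_mult)
    then show ?case using elim
      by (simp add: lower_powr_def powr_def)
  qed
  have "((\<lambda>z. cmod (z - a)) \<longlongrightarrow> cmod (a - a)) (at a within A)" by (intro tendsto_intros)
  then show "((\<lambda>z. cmod (z - a) powr p) \<longlongrightarrow> 0) (at a within A)"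
    using assms by (intro tendsto_zero_powrI[OF _ tendsto_const]) auto
qed

text \<open>
  At a crest \<open>1 / Z'\<close> behaves like the power \<open>1 - \<theta> / \<pi>\<close>, which is positive.
\<close>

lemma angular_crest_inverse_Z_deriv:
  assumes "angular_crest W F \<theta> a" "\<theta> < pi"
  shows "((\<lambda>z. inverse (Z_deriv W F z)) \<longlongrightarrow> 0) (at (of_real a) within closed_lower_half_plane)"
proof -
  define p where "p = 1 - \<theta> / pi"
  have p: "0 < p" using assms(2) by (simp add: p_def)
  obtain C where C: "C \<noteq> 0" and lim: "((\<lambda>z. lower_powr (z - of_real a) p * Z_deriv W F z) \<longlongrightarrow> C)
      (at (of_real a) within closed_lower_half_plane)"
    using assms(1) by (auto simp: angular_crest_def p_def)
  have "((\<lambda>z. lower_powr (z - of_real a) p * inverse (lower_powr (z - of_real a) p * Z_deriv W F z))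
      \<longlongrightarrow> 0 * inverse C) (at (of_real a) within closed_lower_half_plane)"
    by (intro tendsto_intros lower_powr_tendsto_zero p lim C)
  moreover have "lower_powr w p * inverse (lower_powr w p * y) = inverse y" for w y
    by (simp add: lower_powr_def)
  ultimately show ?thesis by (simp only: mult_zero_left)
qed

text \<open>
  At a boundary point the closed half plane splits into the open half plane, where the limit of \<open>U\<close> is
  given, and the real line, where continuity of \<open>u\<close> supplies the same limit.
\<close>

lemma continuous_on_boundary_extension:
  fixes U :: "complex \<Rightarrow> complex" and u :: "real \<Rightarrow> complex"
  assumes "U holomorphic_on lower_half_plane" and u: "continuous_on UNIV u"
    and lim: "\<And>t. (U \<longlongrightarrow> u t) (at (of_real t) within lower_half_plane)"
  shows "continuous_on closed_lower_half_plane (\<lambda>z. if Im z < 0 then U z else u (Re z))"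
  unfolding continuous_on_def
proof
  let ?V = "\<lambda>z. if Im z < 0 then U z else u (Re z)"
  fix z assume z: "z \<in> closed_lower_half_plane"
  show "(?V \<longlongrightarrow> ?V z) (at z within closed_lower_half_plane)"
  proof (cases "Im z < 0")
    case True
    have "(U \<longlongrightarrow> U z) (at z)"
      using holomorphic_on_imp_continuous_on[OF assms(1)] continuous_on_eq_continuous_at[OF open_halfspace_Im_lt] True
      by (auto simp: continuous_at)
    then have "(U \<longlongrightarrow> U z) (at z within closed_lower_half_plane)" by (rule tendsto_within_subset) simp
    moreover have "\<forall>\<^sub>F w in at z within closed_lower_half_plane. U w = ?V w"
      using eventually_at_in_open'[OF open_halfspace_Im_lt, of z 0] True
      by (auto simp: eventually_at_filter elim!: eventually_mono)
    ultimately show ?thesis using True by (simp add: tendsto_cong)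
  next
    case False
    then have zr: "z = of_real (Re z)" using z by (simp add: complex_eq_iff)
    have "(u \<longlongrightarrow> u (Re z)) (nhds (Re z))"
      using u by (simp add: continuous_on_def tendsto_nhds_iff)
    then have "((\<lambda>w. u (Re w)) \<longlongrightarrow> u (Re z)) (at z within {w. Im w = 0})"
      by (rule filterlim_compose) (intro tendsto_intros)
    moreover have "\<forall>\<^sub>F w in at z within {w. Im w = 0}. u (Re w) = ?V w"
      by (simp add: eventually_at_filter)
    ultimately have 1: "(?V \<longlongrightarrow> u (Re z)) (at z within {w. Im w = 0})"
      by (rule Lim_transform_eventually)
    have "(U \<longlongrightarrow> u (Re z)) (at z within lower_half_plane)" using lim[of "Re z"] zr by simp
    moreover have "\<forall>\<^sub>F w in at z within lower_half_plane. U w = ?V w"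
      by (simp add: eventually_at_filter)
    ultimately have 2: "(?V \<longlongrightarrow> u (Re z)) (at z within lower_half_plane)"
      by (rule Lim_transform_eventually)
    have "closed_lower_half_plane = lower_half_plane \<union> {w. Im w = 0}" by auto
    then show ?thesis using 1 2 False by (simp add: Lim_within_Un)
  qed
qed

section \<open>Nonexistence\<close>

text \<open>
  The analytic core. The wave enters through the holomorphic function \<open>R = F' / (1 + F')\<close>, which is
  continuous up to the boundary even at crests, and through the equation in the form
  \<open>Im F = a/2 (1 - \<bar>1 - R\<bar>\<^sup>2)\<close>. This equation is differentiated along the
  line off the finite set \<open>S\<close>; continuity across \<open>S\<close> glues the resulting constants. The case \<open>a = 0\<close> starts
  directly from \<open>Im F = 0\<close> on the line.
\<close>

lemma bernoulli_wave_trivial: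
  fixes F R :: "complex \<Rightarrow> complex" and D :: "real \<Rightarrow> complex" and a M :: real
  assumes F: "continuous_on closed_lower_half_plane F" "F holomorphic_on lower_half_plane"
    and R: "continuous_on closed_lower_half_plane R" "R holomorphic_on lower_half_plane"
    and R_bounded: "\<And>z. Im z < 0 \<Longrightarrow> cmod (R z) \<le> M"
    and R_lim: "((\<lambda>t. R (of_real t)) \<longlongrightarrow> 0) at_infinity"
    and R_eq: "\<And>z. Im z < 0 \<Longrightarrow> 1 + deriv F z \<noteq> 0 \<and> R z = deriv F z / (1 + deriv F z)"
    and S: "finite S"
    and D: "\<And>t. t \<notin> S \<Longrightarrow> ((\<lambda>t. F (of_real t)) has_vector_derivative D t) (at t)"
      "\<And>t. t \<notin> S \<Longrightarrow> 1 + D t \<noteq> 0 \<and> R (of_real t) = D t / (1 + D t)"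
    and "0 \<le> a" and bernoulli: "\<And>t. Im (F (of_real t)) = a / 2 * (1 - (cmod (1 - R (of_real t)))\<^sup>2)"
    and z: "Im z < 0"
  shows "R z = 0"
proof -
  note opn = open_halfspace_Im_lt[of 0]
  have R_sub: "sublinear R"
    by (rule bounded_imp_sublinear[OF eventually_mono[OF eventually_lower_half_plane R_bounded]])
  have R0: "(R \<longlongrightarrow> 0) lower_infinity"
    by (rule half_plane_vanishing[OF R R_sub R_lim])
  have F'_eq: "deriv F z = R z / (1 - R z)" "R z = deriv F z * (1 - R z)" if "Im z < 0" for z
    using R_eq[OF that] by (simp_all add: field_simps)
  have "((\<lambda>z. R z / (1 - R z)) \<longlongrightarrow> 0 / (1 - 0)) lower_infinity"
    by (intro tendsto_intros R0) simp
  then have "((\<lambda>z. R z / (1 - R z)) \<longlongrightarrow> 0) lower_infinity" by simp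
  then have F'0: "(deriv F \<longlongrightarrow> 0) lower_infinity"
    by (rule Lim_transform_eventually[OF _ eventually_mono[OF eventually_lower_half_plane]])
       (use F'_eq in auto)
  have F_sub: "sublinear F"
    by (rule vanishing_deriv_imp_sublinear[OF F(2) F'0])
  have F_deriv: "(F has_field_derivative deriv F z) (at z)" if "Im z < 0" for z
    using holomorphic_derivI[OF F(2) opn] that by simp
  have R_deriv: "(R has_field_derivative deriv R z) (at z)" if "Im z < 0" for z
    using holomorphic_derivI[OF R(2) opn] that by simp
  define v where "v = (\<lambda>t. Im (F (of_real t)))"
  have v_lim: "(v \<longlongrightarrow> 0) at_infinity"
  proof -
    have "((\<lambda>t. a / 2 * (1 - (cmod (1 - R (of_real t)))\<^sup>2)) \<longlongrightarrow> a / 2 * (1 - (cmod (1 - 0))\<^sup>2)) at_infinity"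
      by (intro tendsto_intros R_lim)
    then show ?thesis by (simp add: v_def bernoulli)
  qed

  have flat: "v t = 0" for t
  proof (cases "a = 0")
    case True
    then show ?thesis by (simp add: v_def bernoulli)
  next
    case False
    then have a: "0 < a" using \<open>0 \<le> a\<close> by simp

    \<comment> \<open>On the line \<open>Re N = a Re R - Im F = a/2 \<bar>R\<bar>\<^sup>2\<close>. Since \<open>\<i> F' = N' - a R'\<close>, the gradient
        bounds for \<open>N\<close> and \<open>R\<close> give \<open>F' = o(1 / \<bar>Im z\<bar>)\<close>.\<close>
    define N where "N = (\<lambda>z. of_real a * R z + \<i> * F z)"
    have N: "continuous_on closed_lower_half_plane N" "N holomorphic_on lower_half_plane"
      unfolding N_def by (intro continuous_intros holomorphic_intros F R)+
    have N_sub: "sublinear N"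
    proof -
      have "((\<lambda>w. of_real a * (R w / w) + \<i> * (F w / w)) \<longlongrightarrow> of_real a * 0 + \<i> * 0) lower_infinity"
        by (intro tendsto_intros R_sub F_sub)
      then show ?thesis by (simp add: N_def add_divide_distrib)
    qed
    have N_bdry: "Re (N (of_real t)) = a / 2 * (cmod (R (of_real t)))\<^sup>2" for t
      unfolding N_def cmod_power2 by (simp add: bernoulli cmod_power2) (simp add: algebra_simps power2_eq_square)
    have N_nonneg: "0 \<le> Re (N z)" if "Im z < 0" for z
      by (rule half_plane_nonneg[OF N N_sub _ that]) (simp add: N_bdry a less_imp_le)
    have "((\<lambda>t. a / 2 * (cmod (R (of_real t)))\<^sup>2) \<longlongrightarrow> a / 2 * (cmod 0)\<^sup>2) at_infinity"
      by (intro tendsto_intros R_lim)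
    then have N_lim: "((\<lambda>z. Re (N z)) \<longlongrightarrow> 0) lower_infinity"
      by (intro half_plane_vanishing_Re[OF N N_sub]) (simp add: N_bdry)
    have N'_decay: "((\<lambda>z. of_real (Im z) * deriv N z) \<longlongrightarrow> 0) lower_infinity"
      by (rule nonneg_Re_vanishing_imp_deriv_decay[OF N(2) _ N_lim]) (rule N_nonneg)
    have N'_eq: "deriv N z = of_real a * deriv R z + \<i> * deriv F z" if "Im z < 0" for z
      unfolding N_def by (rule DERIV_imp_deriv) (auto intro!: derivative_eq_intros F_deriv R_deriv that)
    have R'_decay: "((\<lambda>z. of_real (Im z) * deriv R z) \<longlongrightarrow> 0) lower_infinity"
      by (rule vanishing_imp_deriv_decay[OF R(2) R0])
    have F'_decay: "((\<lambda>z. of_real (Im z) * deriv F z) \<longlongrightarrow> 0) lower_infinity"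
    proof -
      have "((\<lambda>z. - \<i> * (of_real (Im z) * deriv N z - of_real a * (of_real (Im z) * deriv R z)))
          \<longlongrightarrow> - \<i> * (0 - of_real a * 0)) lower_infinity"
        by (intro tendsto_intros N'_decay R'_decay)
      then have "((\<lambda>z. - \<i> * (of_real (Im z) * deriv N z - of_real a * (of_real (Im z) * deriv R z)))
          \<longlongrightarrow> 0) lower_infinity" by simp
      then show ?thesis
        by (rule Lim_transform_eventually[OF _ eventually_mono[OF eventually_lower_half_plane]])
           (simp add: N'_eq algebra_simps)
    qed

    \<comment> \<open>The primitive of \<open>R\<close> up to the boundary; \<open>F - G\<close> has the derivative \<open>F' - R = R F'\<close>, which is
        quadratic in quantities of size \<open>o(1 / \<bar>Im z\<bar>)\<close>.\<close>
    obtain G where G: "\<And>z. Im z \<le> 0 \<Longrightarrow> (G has_field_derivative R z) (at z within closed_lower_half_plane)"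
    proof (rule holomorphic_convex_primitive[OF convex_halfspace_Im_le finite.emptyI R(1)])
      fix z assume z: "z \<in> interior closed_lower_half_plane - {}"
      show "R field_differentiable at z"
        using z R_deriv by (auto simp: field_differentiable_def interior_closed_lower_half_plane)
    next
      fix G assume "\<And>z. z \<in> closed_lower_half_plane \<Longrightarrow>
          (G has_field_derivative R z) (at z within closed_lower_half_plane)"
      then show thesis by (intro that[of G]) simp
    qed
    have G_cont: "continuous_on closed_lower_half_plane G"
      by (rule DERIV_continuous_on) (use G in auto)
    have G_deriv: "(G has_field_derivative R z) (at z)" if "Im z < 0" for z
    proof -
      have "(G has_field_derivative R z) (at z within lower_half_plane)"
        by (rule has_field_derivative_subset[OF G]) (use that in auto)
      then show ?thesis using at_within_open[OF _ opn] that by simp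
    qed
    have G_holo: "G holomorphic_on lower_half_plane"
      using G_deriv by (auto simp: holomorphic_on_open[OF opn])
    have G_bdry: "((\<lambda>t. G (of_real t)) has_vector_derivative R (of_real t)) (at t)" for t
    proof -
      have "((G \<circ> of_real) has_vector_derivative (1 * R (of_real t))) (at t within UNIV)"
      proof (rule field_vector_diff_chain_within)
        show "(of_real has_vector_derivative 1) (at t within UNIV)"
          using has_vector_derivative_of_real[OF DERIV_ident[of "at t"]] by simp
        show "(G has_field_derivative R (of_real t)) (at (of_real t) within range of_real)"
          by (rule has_field_derivative_subset[OF G]) auto
      qed
      then show ?thesis by (simp add: o_def)
    qed

    \<comment> \<open>With \<open>Z = 1 + D\<close>, both \<open>(v\<^sup>2 / a)'\<close> and \<open>Im (D - R)\<close> are equal to \<open>Im Z - Im Z / \<bar>Z\<bar>\<^sup>2\<close>.\<close>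
    define e where "e = (\<lambda>t. Im (F (of_real t) - G (of_real t)) - (v t)\<^sup>2 / a)"
    have e_const: "e t = e 0" for t
    proof (rule has_derivative_zero_unique_strong_convex[of UNIV S e 0 "e 0" t])
      have "continuous_on UNIV (\<lambda>t. F (of_real t))" "continuous_on UNIV (\<lambda>t. G (of_real t))"
        by (auto intro!: continuous_on_compose2[OF F(1)] continuous_on_compose2[OF G_cont] continuous_intros)
      then show "continuous_on UNIV e" unfolding e_def v_def by (intro continuous_intros) (use a in auto)
      fix t assume "t \<in> UNIV - S"
      then have t: "t \<notin> S" by simp
      define Z where "Z = 1 + D t"
      have Z: "Z \<noteq> 0" "R (of_real t) = 1 - inverse Z" "D t = Z - 1"
        using D(2)[OF t] by (auto simp: Z_def field_simps)
      have "((\<lambda>t. F (of_real t) - G (of_real t)) has_vector_derivative (D t - R (of_real t))) (at t)"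
        by (intro has_vector_derivative_diff D(1) t G_bdry)
      then have 1: "((\<lambda>t. Im (F (of_real t) - G (of_real t))) has_real_derivative Im (D t - R (of_real t))) (at t)"
        unfolding has_real_derivative_iff_has_vector_derivative
        by (rule bounded_linear.has_vector_derivative[OF bounded_linear_Im])
      have 2: "(v has_real_derivative Im (D t)) (at t)"
        unfolding has_real_derivative_iff_has_vector_derivative v_def
        by (rule bounded_linear.has_vector_derivative[OF bounded_linear_Im]) (rule D(1)[OF t])
      have "((\<lambda>t. (v t)\<^sup>2 / a) has_real_derivative 2 * v t * Im (D t) / a) (at t)"
        using a by (auto intro!: derivative_eq_intros 2)
      then have "(e has_real_derivative Im (D t - R (of_real t)) - 2 * v t * Im (D t) / a) (at t)"
        unfolding e_def by (rule DERIV_diff[OF 1])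
      moreover have "2 * v t * Im (D t) / a = (1 - (cmod (inverse Z))\<^sup>2) * Im Z"
        using a by (simp add: v_def bernoulli Z)
      moreover have "Im (D t - R (of_real t)) = Im Z - (cmod (inverse Z))\<^sup>2 * Im Z"
        using Z(1) by (simp add: Z norm_inverse cmod_power2 power_inverse divide_inverse)
      ultimately have "(e has_real_derivative (Im Z - (cmod (inverse Z))\<^sup>2 * Im Z) - (1 - (cmod (inverse Z))\<^sup>2) * Im Z) (at t)"
        by simp
      then have "(e has_real_derivative 0) (at t)" by (simp add: left_diff_distrib)
      moreover have "(*) 0 = (\<lambda>h::real. 0 :: real)" by auto
      ultimately show "(e has_derivative (\<lambda>h. 0)) (at t within UNIV)"
        by (simp add: has_field_derivative_def)
    qed (use S in auto)

    \<comment> \<open>\<open>Re f = Im (F - G)\<close>, normalised to have the boundary values \<open>v\<^sup>2 / a\<close>.\<close>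
    define f where "f = (\<lambda>z. - \<i> * (F z - G z) - of_real (e 0))"
    have f: "continuous_on closed_lower_half_plane f" "f holomorphic_on lower_half_plane"
      unfolding f_def by (intro continuous_intros holomorphic_intros F G_cont G_holo)+
    have f': "deriv f z = - \<i> * (deriv F z - R z)" if "Im z < 0" for z
      unfolding f_def by (rule DERIV_imp_deriv) (auto intro!: derivative_eq_intros F_deriv G_deriv that)
    have f_bdry: "Re (f (of_real t)) = (v t)\<^sup>2 / a" for t
      using e_const[of t] by (simp add: f_def e_def)
    have f_sub: "sublinear f"
    proof (rule vanishing_deriv_imp_sublinear[OF f(2)])
      have "((\<lambda>z. - \<i> * (deriv F z - R z)) \<longlongrightarrow> - \<i> * (0 - 0)) lower_infinity"
        by (intro tendsto_intros F'0 R0)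
      then have "((\<lambda>z. - \<i> * (deriv F z - R z)) \<longlongrightarrow> 0) lower_infinity" by simp
      then show "(deriv f \<longlongrightarrow> 0) lower_infinity"
        by (rule Lim_transform_eventually[OF _ eventually_mono[OF eventually_lower_half_plane]])
           (simp add: f')
    qed
    have "Re (f (of_real t)) = 0"
    proof (rule half_plane_rigidity[OF f f_sub])
      show "0 \<le> Re (f (of_real t))" for t using a by (simp add: f_bdry)
      have "((\<lambda>t. (v t)\<^sup>2 / a) \<longlongrightarrow> 0\<^sup>2 / a) at_infinity"
        by (intro tendsto_intros v_lim) (use a in auto)
      then show "((\<lambda>t. Re (f (of_real t))) \<longlongrightarrow> 0) at_infinity" by (simp add: f_bdry)
      have "((\<lambda>z. - \<i> * (of_real (Im z) * deriv F z)\<^sup>2 * (1 - R z)) \<longlongrightarrow> - \<i> * 0\<^sup>2 * (1 - 0)) lower_infinity"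
        by (intro tendsto_intros F'_decay R0)
      then have "((\<lambda>z. - \<i> * (of_real (Im z) * deriv F z)\<^sup>2 * (1 - R z)) \<longlongrightarrow> 0) lower_infinity" by simp
      then show "((\<lambda>z. of_real ((Im z)\<^sup>2) * deriv f z) \<longlongrightarrow> 0) lower_infinity"
      proof (rule Lim_transform_eventually[OF _ eventually_mono[OF eventually_lower_half_plane]])
        fix z :: complex assume z: "Im z < 0"
        have "deriv F z - R z = deriv F z * deriv F z * (1 - R z)"
        proof -
          have "deriv F z - R z = deriv F z - deriv F z * (1 - R z)" using F'_eq(2)[OF z] by simp
          also have "\<dots> = deriv F z * R z" by (simp add: algebra_simps)
          also have "\<dots> = deriv F z * (deriv F z * (1 - R z))" using F'_eq(2)[OF z] by simp
          finally show ?thesis by (simp add: mult.assoc)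
        qed
        then show "- \<i> * (of_real (Im z) * deriv F z)\<^sup>2 * (1 - R z) = of_real ((Im z)\<^sup>2) * deriv f z"
          by (simp add: f'[OF z] power2_eq_square)
      qed
    qed
    then show ?thesis using a by (simp add: f_bdry)
  qed
  have "deriv (\<lambda>z. - \<i> * F z) z = 0"
  proof (rule half_plane_zero_boundary_deriv[OF _ _ _ _ z])
    show "((\<lambda>w. - \<i> * F w / w) \<longlongrightarrow> 0) lower_infinity"
      using tendsto_mult_right_zero[OF F_sub, of "- \<i>"] by simp
    show "Re (- \<i> * F (of_real t)) = 0" for t using flat[of t] by (simp add: v_def)
  qed (intro continuous_intros holomorphic_intros F)+
  moreover have "deriv (\<lambda>z. - \<i> * F z) z = - \<i> * deriv F z"
    by (rule DERIV_imp_deriv) (auto intro!: derivative_eq_intros F_deriv z)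
  ultimately show "R z = 0" using R_eq[OF z] by simp
qed

theorem corollary3p2:
  fixes g c :: real and \<psi> :: "real \<Rightarrow> real"
  assumes "g > 0" and "littlewood_paley \<psi>"
  shows "\<not> (\<exists>(W :: real \<Rightarrow> complex) (F :: complex \<Rightarrow> complex) (S :: real set).
            holomorphic_wave W F S \<and> crested_wave W F S \<and>
            (\<forall>\<alpha>. \<alpha> \<notin> S \<longrightarrow> wave_equation g c W \<alpha>) \<and>
            (\<exists>u \<in> besov_half \<psi>. \<forall>\<alpha>. \<alpha> \<notin> S \<longrightarrow> u \<alpha> = R_wave W \<alpha>) \<and>
            (\<exists>\<delta>>0. \<forall>\<alpha>. \<alpha> \<notin> S \<longrightarrow> \<delta> \<le> cmod (1 + d_alpha W \<alpha>)))"
proof (rule notI, elim exE conjE bexE)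
  fix W F S u \<delta>
  assume hw: "holomorphic_wave W F S" and cw: "crested_wave W F S"
    and eqn: "\<forall>\<alpha>. \<alpha> \<notin> S \<longrightarrow> wave_equation g c W \<alpha>"
    and ub: "u \<in> besov_half \<psi>" and uR: "\<forall>\<alpha>. \<alpha> \<notin> S \<longrightarrow> u \<alpha> = R_wave W \<alpha>"
    and \<delta>: "0 < \<delta>" "\<forall>\<alpha>. \<alpha> \<notin> S \<longrightarrow> \<delta> \<le> cmod (1 + d_alpha W \<alpha>)"
  have F: "continuous_on closed_lower_half_plane F" "F holomorphic_on lower_half_plane"
    and FW: "\<And>t. F (of_real t) = W t" and F'_nz: "\<And>z. Im z < 0 \<Longrightarrow> 1 + deriv F z \<noteq> 0"
    using hw by (auto simp: holomorphic_wave_def)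
  define R0 where "R0 = (\<lambda>z. deriv F z / (1 + deriv F z))"
  have R0: "R0 holomorphic_on lower_half_plane" "bounded (R0 ` lower_half_plane)"
    "\<And>t. t \<notin> S \<Longrightarrow> (R0 \<longlongrightarrow> R_wave W t) (at (of_real t) within lower_half_plane)"
    using hw by (auto simp: holomorphic_wave_def bounded_holo_extension_def R0_def)
  have S: "finite S" "S \<noteq> {}" using cw by (auto simp: crested_wave_def)
  have u: "continuous_on UNIV u" using ub by (simp add: besov_half_def)
  have D_nz: "1 + d_alpha W t \<noteq> 0" if "t \<notin> S" for t
  proof
    assume "1 + d_alpha W t = 0"
    then show False using \<delta> that by force
  qed
  have D: "(W has_vector_derivative d_alpha W t) (at t)" if "t \<notin> S" for t
  proof -
    have "W differentiable (at t)"
      using cw that unfolding crested_wave_def smooth_on_def by (metis ComplI funpow_0)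
    then show ?thesis by (simp add: vector_derivative_works)
  qed
  have off_S: "\<forall>\<^sub>F t in at s. t \<notin> S" for s
  proof -
    have "open (- (S - {s}))" using S(1) by (intro open_Compl finite_imp_closed) simp
    then show ?thesis unfolding eventually_at_topological by (intro exI[of _ "- (S - {s})"]) auto
  qed
  have u_off: "u t = 1 - inverse (Z_deriv W F (of_real t))" if "t \<notin> S" for t
    using uR that D_nz[OF that] by (simp add: R_wave_def Z_deriv_def divide_simps)
  have R0_eq: "R0 z = 1 - inverse (Z_deriv W F z)" if "Im z < 0" for z
    using F'_nz[OF that] that by (simp add: R0_def Z_deriv_def divide_simps)

  have crest: "((\<lambda>z. 1 - inverse (Z_deriv W F z)) \<longlongrightarrow> 1) (at (of_real s) within closed_lower_half_plane)"
    if "s \<in> S" for s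
  proof -
    obtain \<theta> where "\<theta> < pi" "angular_crest W F \<theta> s"
      using cw \<open>s \<in> S\<close> by (auto simp: crested_wave_def)
    then have "((\<lambda>z. 1 - inverse (Z_deriv W F z)) \<longlongrightarrow> 1 - 0) (at (of_real s) within closed_lower_half_plane)"
      by (intro tendsto_intros angular_crest_inverse_Z_deriv)
    then show ?thesis by simp
  qed
  \<comment> \<open>\<open>u\<close> is not prescribed at the crests, but its continuity determines it there.\<close>
  have u_crest: "u s = 1" if "s \<in> S" for s
  proof -
    have "filterlim (of_real :: real \<Rightarrow> complex) (at (of_real s) within closed_lower_half_plane) (at s)"
      unfolding filterlim_at by (auto simp: eventually_at_filter intro!: tendsto_intros)
    then have "((\<lambda>t. 1 - inverse (Z_deriv W F (of_real t))) \<longlongrightarrow> 1) (at s)"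
      by (rule filterlim_compose[OF crest[OF that]])
    then have "(u \<longlongrightarrow> 1) (at s)"
      by (rule Lim_transform_eventually) (use off_S[of s] in eventually_elim, simp add: u_off)
    moreover have "(u \<longlongrightarrow> u s) (at s)" using u by (simp add: continuous_on_def)
    ultimately show ?thesis using tendsto_unique[OF at_neq_bot] by blast
  qed
  have R0_lim: "(R0 \<longlongrightarrow> u t) (at (of_real t) within lower_half_plane)" for t
  proof (cases "t \<in> S")
    case True
    have "((\<lambda>z. 1 - inverse (Z_deriv W F z)) \<longlongrightarrow> 1) (at (of_real t) within lower_half_plane)"
      by (rule tendsto_within_subset[OF crest[OF True]]) auto
    then have "(R0 \<longlongrightarrow> 1) (at (of_real t) within lower_half_plane)"
      by (rule Lim_transform_eventually) (simp add: eventually_at_filter R0_eq)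
    then show ?thesis using u_crest[OF True] by simp
  qed (use R0(3) uR in simp)

  define R where "R = (\<lambda>z. if Im z < 0 then R0 z else u (Re z))"
  have R_real: "R (of_real t) = u t" for t by (simp add: R_def)
  have R: "continuous_on closed_lower_half_plane R" "R holomorphic_on lower_half_plane"
  proof -
    show "continuous_on closed_lower_half_plane R"
      unfolding R_def by (rule continuous_on_boundary_extension[OF R0(1) u R0_lim])
    show "R holomorphic_on lower_half_plane"
      using R0(1) by (rule holomorphic_transform) (simp add: R_def)
  qed
  obtain M where M: "\<And>z. Im z < 0 \<Longrightarrow> cmod (R z) \<le> M"
    using R0(2) by (auto simp: bounded_iff R_def)

  define a where "a = c\<^sup>2 / g"
  \<comment> \<open>The Bernoulli equation holds off the crests; both sides are continuous, so it holds at the crests too.\<close>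
  define h where "h = (\<lambda>t. Im (F (of_real t)) - a / 2 * (1 - (cmod (1 - R (of_real t)))\<^sup>2))"
  have h_off: "h t = 0" if "t \<notin> S" for t
  proof -
    define Z where "Z = 1 + d_alpha W t"
    have Z: "Z \<noteq> 0" "d_alpha W t = Z - 1" using D_nz[OF that] by (simp_all add: Z_def)
    have "d_alpha W t + cnj (d_alpha W t) + of_real ((cmod (d_alpha W t))\<^sup>2) = of_real ((cmod Z)\<^sup>2 - 1)"
      unfolding of_real_diff complex_norm_square Z(2) by (simp add: algebra_simps)
    then have "of_real (2 * g * Im (W t)) = (of_real (c\<^sup>2 * (((cmod Z)\<^sup>2 - 1) / (cmod Z)\<^sup>2)) :: complex)"
      using eqn that by (simp add: wave_equation_def flip: Z_def)
    then have "2 * g * Im (W t) = c\<^sup>2 * (((cmod Z)\<^sup>2 - 1) / (cmod Z)\<^sup>2)"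
      unfolding of_real_eq_iff .
    moreover have "1 - u t = inverse Z"
      using u_off[OF that] by (simp add: Z_deriv_def Z_def)
    then have "(cmod (1 - u t))\<^sup>2 = 1 / (cmod Z)\<^sup>2"
      by (simp add: norm_inverse power_inverse divide_inverse)
    then have "((cmod Z)\<^sup>2 - 1) / (cmod Z)\<^sup>2 = 1 - (cmod (1 - u t))\<^sup>2"
      using Z(1) by (simp add: diff_divide_distrib)
    ultimately show ?thesis using \<open>g > 0\<close> by (simp add: h_def a_def FW R_real field_simps)
  qed
  have "continuous_on UNIV h"
    unfolding h_def R_real
    by (intro continuous_intros u continuous_on_compose2[OF F(1)]) auto
  then have h: "h t = 0" for t
  proof -
    assume "continuous_on UNIV h"
    then have "(h \<longlongrightarrow> h t) (at t)" by (simp add: continuous_on_def)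
    moreover have "(h \<longlongrightarrow> 0) (at t)"
      by (rule Lim_transform_eventually[OF tendsto_const])
         (use off_S[of t] in eventually_elim, simp add: h_off)
    ultimately show ?thesis using tendsto_unique[OF at_neq_bot] by blast
  qed

  have R_zero: "R z = 0" if "Im z < 0" for z
  proof (rule bernoulli_wave_trivial[OF F R M])
    show "((\<lambda>t. R (of_real t)) \<longlongrightarrow> 0) at_infinity"
      unfolding R_real using assms(2) ub by (rule besov_half_vanishing_at_infinity)
    show "1 + deriv F z \<noteq> 0 \<and> R z = deriv F z / (1 + deriv F z)" if "Im z < 0" for z
      using F'_nz that by (simp add: R_def R0_def)
    show "((\<lambda>t. F (of_real t)) has_vector_derivative d_alpha W t) (at t)" if "t \<notin> S" for t
      using D[OF that] by (simp add: FW)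
    show "1 + d_alpha W t \<noteq> 0 \<and> R (of_real t) = d_alpha W t / (1 + d_alpha W t)" if "t \<notin> S" for t
      using D_nz[OF that] uR that by (simp add: R_real R_wave_def)
    show "0 \<le> a" using \<open>g > 0\<close> by (simp add: a_def)
    show "Im (F (of_real t)) = a / 2 * (1 - (cmod (1 - R (of_real t)))\<^sup>2)" for t
      using h[of t] by (simp add: h_def)
  qed (use S that in auto)
  have "closure lower_half_plane = closed_lower_half_plane"
    using closure_halfspace_lt[of "\<i>" 0] by (simp add: inner_complex_def)
  then have "R (of_real s) = 0" for s
    using continuous_constant_on_closure[of lower_half_plane R 0 "of_real s"] R(1) R_zero by simp
  then show False using S(2) u_crest R_real by fastforce
qed

end
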